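(* Let $V\in\mathcal{S}(\mathbb{R})$ be real-valued and let $m_\pm(x,k)$ be the modified Jost functions of $H=-\frac{d^2}{dx^2}+V$. Then $m_\pm\in C^\infty(\mathbb{R}\times\mathbb{R})$, and for all integers $\ell,n\ge0$ there is a constant $c_{n,\ell}$ such that for all $x,k\in\mathbb{R}$ $$|\partial_x^\ell\partial_k^nm_\pm(x,k)|\le c_{n,\ell}\begin{cases}(1+\max(0,\mp x))^n,&\ell\ge1,\\(1+\max(0,\mp x))^{n+1},&\ell=0.\end{cases}$$ Moreover, if $\ell\ge0$, $n\ge1$, or $\ell\ge1$, $n\ge0$, then there is a constant $c_{n,\ell}$ such that for all $x\in\mathbb{R}$ and $k\in\mathbb{R}\setminus\{0\}$ $$|\partial_x^\ell\partial_k^nm_\pm(x,k)|\le c_{n,\ell}\frac{(1+\max(0,\mp x))^n}{|k|^n}.$$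
   Context: For $k\in\mathbb{R}$ the Jost functions $f_\pm(x,k)$ are the solutions of $-f''+Vf=k^2f$ with $f_\pm(x,k)\sim e^{\pm ikx}$ as $x\to\pm\infty$. The modified Jost functions are $m_\pm(x,k)=e^{\mp ikx}f_\pm(x,k)$; they tend to $1$ as $x\to\pm\infty$. Equivalently, $m_+$ solves $m_+(x,k)=1+\int_x^\infty h(t-x,k)V(t)m_+(t,k)\,dt$ with $h(u,k)=\int_0^ue^{2ikv}\,dv$, and analogously for $m_-$. *)

theory Defs
  imports "HOL-Analysis.Analysis" "HOL-Library.Landau_Symbols"
begin

definition schwartz :: "(real \<Rightarrow> real) \<Rightarrow> bool" where
  "schwartz V \<longleftrightarrow>
     (\<forall>n x. (deriv ^^ n) V field_differentiable (at x)) \<and>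
     (\<forall>j n. bounded (range (\<lambda>x. x ^ j * (deriv ^^ n) V x)))"

text \<open>In finite dimension, continuity of all directional derivatives
  is continuity of the Frechet derivative.\<close>

primrec C_n :: "nat \<Rightarrow> ('a::euclidean_space \<Rightarrow> 'b::real_normed_vector) \<Rightarrow> bool" where
  "C_n 0 f \<longleftrightarrow> continuous_on UNIV f"
| "C_n (Suc n) f \<longleftrightarrow> (\<forall>p. f differentiable (at p)) \<and>
     (\<forall>v. C_n n (\<lambda>p. frechet_derivative f (at p) v))"

definition C_infinity :: "('a::euclidean_space \<Rightarrow> 'b::real_normed_vector) \<Rightarrow> bool" where
  "C_infinity f \<longleftrightarrow> (\<forall>n. C_n n f)"

definition partial_x :: "(real \<Rightarrow> real \<Rightarrow> complex) \<Rightarrow> real \<Rightarrow> real \<Rightarrow> complex" where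
  "partial_x g = (\<lambda>x k. vector_derivative (\<lambda>y. g y k) (at x))"

definition partial_k :: "(real \<Rightarrow> real \<Rightarrow> complex) \<Rightarrow> real \<Rightarrow> real \<Rightarrow> complex" where
  "partial_k g = (\<lambda>x k. vector_derivative (\<lambda>q. g x q) (at k))"

definition schroedinger_solution :: "(real \<Rightarrow> real) \<Rightarrow> real \<Rightarrow> (real \<Rightarrow> complex) \<Rightarrow> bool" where
  "schroedinger_solution V k f \<longleftrightarrow>
     (\<exists>f' f''. \<forall>x. (f has_vector_derivative f' x) (at x) \<and>
                (f' has_vector_derivative f'' x) (at x) \<and>
                - f'' x + of_real (V x) * f x = of_real (k\<^sup>2) * f x)"

text \<open>For Schwartz \<open>V\<close> and every real \<open>k\<close> (including \<open>k = 0\<close>) the asymptotic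
  condition on one side singles out exactly one solution.\<close>

definition jost_plus :: "(real \<Rightarrow> real) \<Rightarrow> real \<Rightarrow> real \<Rightarrow> complex" where
  "jost_plus V x k =
     (THE f. schroedinger_solution V k f \<and> f \<sim>[at_top] (\<lambda>y. exp (\<i> * of_real (k * y)))) x"

definition jost_minus :: "(real \<Rightarrow> real) \<Rightarrow> real \<Rightarrow> real \<Rightarrow> complex" where
  "jost_minus V x k =
     (THE f. schroedinger_solution V k f \<and> f \<sim>[at_bot] (\<lambda>y. exp (- \<i> * of_real (k * y)))) x"

definition m_plus :: "(real \<Rightarrow> real) \<Rightarrow> real \<Rightarrow> real \<Rightarrow> complex" where
  "m_plus V x k = exp (- \<i> * of_real (k * x)) * jost_plus V x k"

definition m_minus :: "(real \<Rightarrow> real) \<Rightarrow> real \<Rightarrow> real \<Rightarrow> complex" where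
  "m_minus V x k = exp (\<i> * of_real (k * x)) * jost_minus V x k"

end

theory Submission
  imports Defs
begin

text \<open>With \<open>F = m\<^sub>+ - 1\<close> and \<open>U = \<partial>\<^sub>x m\<^sub>+\<close>, the Schroedinger equation becomes
  \<open>U' + 2 i k U = V F + S\<close> with source \<open>S = V\<close> and \<open>F, U \<rightarrow> 0\<close> at \<open>+\<infinity>\<close>. Since
  \<open>U\<close> equals \<open>- e\<^sup>-\<^sup>2\<^sup>i\<^sup>k\<^sup>x \<integral>\<^sub>x\<^sup>\<infinity> e\<^sup>2\<^sup>i\<^sup>k\<^sup>t (V F + S) dt\<close>, its bounds cost one power of \<open>1 + max 0 (- x)\<close>
  over those of \<open>S\<close> and those of \<open>F\<close> a second one, uniformly in \<open>k\<close>; moreover \<open>U + 2 i k F\<close>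
  is a primitive of \<open>V F + S\<close>, so \<open>k F\<close> obeys the bounds of \<open>U\<close>.
  The functions \<open>\<partial>\<^sub>k\<^sup>n m\<^sub>+\<close>, the functions \<open>k\<^sup>n \<partial>\<^sub>k\<^sup>n m\<^sub>+\<close> and the first- and second-order difference
  quotients in \<open>k\<close> all solve this equation with sources controlled inductively, which gives
  the growth bounds, the decay in \<open>k\<close> and the differentiability in \<open>k\<close> respectively.
  The case of \<open>m\<^sub>-\<close> follows by reflecting \<open>V\<close>.\<close>

section \<open>Integration from infinity\<close>

text \<open>The obstacle is uniformity over all real k, from 0 to infinity. No estimate may divide
  by k, and bounding the terms of \<open>H - 2 i k U\<close> separately fails for large k. Both are
  avoided by estimating only after an oscillating factor of modulus one has been removed, and by
  treating each x-derivative of U as a solution of the same first-order equation with a new source.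
  Solutions are therefore handled as families: k, or a pair of k and an increment, is merely an
  index, and bounds do not depend on the index. The sharp exponents start from a crude polynomial
  bound on F whose degree depends on V; multiplication by V decays at both ends and erases that
  degree. Differentiability in k needs no interchange of limits: a uniform bound on the second-order
  quotients is a quadratic bound on the Taylor remainder.\<close>

lemma increment_bound:
  fixes f :: "real \<Rightarrow> 'a::real_normed_vector"
  assumes "a \<le> b"
    and f: "\<And>x. a \<le> x \<Longrightarrow> x \<le> b \<Longrightarrow> (f has_vector_derivative f' x) (at x)"
    and \<Phi>: "\<And>x. a \<le> x \<Longrightarrow> x \<le> b \<Longrightarrow> (\<Phi> has_real_derivative \<Phi>' x) (at x)"
    and le: "\<And>x. a \<le> x \<Longrightarrow> x \<le> b \<Longrightarrow> norm (f' x) \<le> - \<Phi>' x"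
  shows "norm (f b - f a) \<le> \<Phi> a - \<Phi> b"
proof (cases "a = b")
  case False
  have "norm (f b - f a) \<le> (\<lambda>x. - \<Phi> x) b - (\<lambda>x. - \<Phi> x) a"
  proof (rule differentiable_bound_general[where f' = f'])
    show "a < b" using False assms(1) by simp
    show "continuous_on {a..b} f"
      using f by (intro continuous_at_imp_continuous_on ballI)
        (auto intro: has_vector_derivative_continuous)
    show "continuous_on {a..b} (\<lambda>x. - \<Phi> x)"
      using \<Phi> by (intro continuous_at_imp_continuous_on ballI continuous_minus)
        (auto intro: DERIV_isCont)
    show "((\<lambda>x. - \<Phi> x) has_vector_derivative - \<Phi>' x) (at x)" if "a < x" "x < b" for x
      using that \<Phi>[of x] by (simp add: has_real_derivative_iff_has_vector_derivative
          has_vector_derivative_minus)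
  qed (use f le in auto)
  then show ?thesis by simp
qed simp

text \<open>\<open>\<Phi>\<close> takes the place of the tail integral of a bound on
  \<open>f'\<close>. Comparison with explicit decreasing functions replaces the estimation of
  integrals throughout.\<close>

lemma tail_bound:
  fixes f :: "real \<Rightarrow> 'a::real_normed_vector"
  assumes f: "\<And>x. a \<le> x \<Longrightarrow> (f has_vector_derivative f' x) (at x)"
    and \<Phi>: "\<And>x. a \<le> x \<Longrightarrow> (\<Phi> has_real_derivative \<Phi>' x) (at x)"
    and le: "\<And>x. a \<le> x \<Longrightarrow> norm (f' x) \<le> - \<Phi>' x"
    and lim: "(f \<longlongrightarrow> 0) at_top" "(\<Phi> \<longlongrightarrow> 0) at_top"
  shows "norm (f a) \<le> \<Phi> a"
proof -
  have "((\<lambda>b. norm (f b - f a)) \<longlongrightarrow> norm (0 - f a)) at_top"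
    using lim by (intro tendsto_intros)
  moreover have "((\<lambda>b. \<Phi> a - \<Phi> b) \<longlongrightarrow> \<Phi> a - 0) at_top"
    using lim by (intro tendsto_intros)
  moreover have "\<forall>\<^sub>F b in at_top. norm (f b - f a) \<le> \<Phi> a - \<Phi> b"
    using eventually_ge_at_top[of a]
    by eventually_elim (rule increment_bound, use f \<Phi> le in auto)
  ultimately have "norm (0 - f a) \<le> \<Phi> a - 0"
    by (intro tendsto_le[OF trivial_limit_at_top_linorder])
  then show ?thesis by simp
qed

section \<open>Integrating factors for U' + 2 i \<kappa> U = H\<close>

abbreviation osc :: "real \<Rightarrow> real \<Rightarrow> complex" where
  "osc \<kappa> x \<equiv> exp (x *\<^sub>R (2 * \<i> * complex_of_real \<kappa>))"

lemma norm_osc [simp]: "norm (osc \<kappa> x) = 1"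
  by (simp add: norm_exp_eq_Re)

lemma osc_has_vector_derivative:
  assumes "(U has_vector_derivative H - 2 * \<i> * of_real \<kappa> * U x) (at x)"
  shows "((\<lambda>x. osc \<kappa> x * U x) has_vector_derivative osc \<kappa> x * H) (at x)"
  using has_vector_derivative_mult[OF exp_scaleR_has_vector_derivative_right assms,
      of "2 * \<i> * complex_of_real \<kappa>"]
  by (simp add: algebra_simps)

lemma tendsto_osc_mult_0:
  assumes "(U \<longlongrightarrow> 0) F"
  shows "((\<lambda>x. osc \<kappa> x * U x) \<longlongrightarrow> 0) F"
  using assms by (subst tendsto_norm_zero_iff[symmetric])
    (simp add: norm_mult tendsto_norm_zero)

text \<open>The integrating factor \<open>osc \<kappa>\<close> has modulus one, so \<kappa> does not
  enter the bound. The uniformity in k rests on this.\<close>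

lemma osc_tail_bound:
  assumes U: "\<And>x. a \<le> x \<Longrightarrow> (U has_vector_derivative H x - 2 * \<i> * of_real \<kappa> * U x) (at x)"
    and \<Phi>: "\<And>x. a \<le> x \<Longrightarrow> (\<Phi> has_real_derivative \<Phi>' x) (at x)"
    and le: "\<And>x. a \<le> x \<Longrightarrow> norm (H x) \<le> - \<Phi>' x"
    and lim: "(U \<longlongrightarrow> 0) at_top" "(\<Phi> \<longlongrightarrow> 0) at_top"
  shows "norm (U a) \<le> \<Phi> a"
proof -
  have "norm (osc \<kappa> a * U a) \<le> \<Phi> a"
    by (rule tail_bound[where f' = "\<lambda>x. osc \<kappa> x * H x" and \<Phi>' = \<Phi>'])
      (use U \<Phi> le lim in \<open>auto intro: osc_has_vector_derivative tendsto_osc_mult_0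
        simp: norm_mult\<close>)
  then show ?thesis by (simp add: norm_mult)
qed

text \<open>Increments of any primitive are controlled by those of \<open>\<Phi>\<close>, which are
  small far out. Hence it converges at infinity, and its limit can be subtracted.\<close>

lemma antiderivative_vanishing_at_top:
  fixes g :: "real \<Rightarrow> complex"
  assumes g: "\<And>x. isCont g x"
    and \<Phi>: "\<And>x. (\<Phi> has_real_derivative \<Phi>' x) (at x)"
    and le: "\<And>x. norm (g x) \<le> - \<Phi>' x"
    and lim: "(\<Phi> \<longlongrightarrow> 0) at_top"
  obtains f where "\<And>x. (f has_vector_derivative g x) (at x)" "(f \<longlongrightarrow> 0) at_top"
proof -
  obtain P where P: "\<And>x. (P has_vector_derivative g x) (at x)"
    using einterval_antiderivative[of "-\<infinity>" "\<infinity>" g] g by auto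
  have inc: "norm (P b - P a) \<le> \<Phi> a - \<Phi> b" if "a \<le> b" for a b
    using that P \<Phi> le by (intro increment_bound) auto
  \<comment> \<open>The zero function satisfies the hypotheses of \<open>tail_bound\<close>, which
    yields the sign of \<open>\<Phi>\<close>.\<close>
  have nonneg: "0 \<le> \<Phi> x" for x
    using tail_bound[of x "\<lambda>_. 0::real" "\<lambda>_. 0" \<Phi> \<Phi>'] \<Phi> lim order_trans[OF norm_ge_zero le]
    by simp
  have "Cauchy (\<lambda>n. P (real n))"
  proof (rule metric_CauchyI)
    fix e :: real assume "0 < e"
    have "((\<lambda>n. \<Phi> (real n)) \<longlongrightarrow> 0) sequentially"
      using lim filterlim_real_sequentially by (rule filterlim_compose)
    from order_tendstoD(2)[OF this \<open>0 < e\<close>]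
    obtain N where N: "\<And>n. n \<ge> N \<Longrightarrow> \<Phi> (real n) < e"
      by (auto simp: eventually_sequentially)
    have *: "dist (P (real m)) (P (real n)) < e" if "N \<le> n" "n \<le> m" for m n
    proof -
      have "dist (P (real m)) (P (real n)) \<le> \<Phi> (real n) - \<Phi> (real m)"
        using inc[of n m] that by (simp add: dist_norm)
      also have "\<dots> < e" using N[of n] nonneg[of m] that by simp
      finally show ?thesis .
    qed
    show "\<exists>M. \<forall>m\<ge>M. \<forall>n\<ge>M. dist (P (real m)) (P (real n)) < e"
      using * by (metis dist_commute nle_le)
  qed
  then obtain L where L: "(\<lambda>n. P (real n)) \<longlonglongrightarrow> L"
    using Cauchy_convergent convergent_def by blast
  have bd: "norm (L - P a) \<le> \<Phi> a" for a
  proof (rule tendsto_le[OF sequentially_bot])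
    show "(\<lambda>n. \<Phi> a) \<longlonglongrightarrow> \<Phi> a" by simp
    show "(\<lambda>n. norm (P (real n) - P a)) \<longlonglongrightarrow> norm (L - P a)"
      using L by (intro tendsto_intros)
    have "\<forall>\<^sub>F n in sequentially. a \<le> real n"
      using filterlim_real_sequentially eventually_ge_at_top
      by (metis filterlim_iff)
    then show "\<forall>\<^sub>F n in sequentially. norm (P (real n) - P a) \<le> \<Phi> a"
      by eventually_elim (use inc nonneg in \<open>smt (verit)\<close>)
  qed
  show thesis
  proof
    show "((\<lambda>x. P x - L) has_vector_derivative g x) (at x)" for x
      using has_vector_derivative_diff[OF P has_vector_derivative_const] by simp
    show "((\<lambda>x. P x - L) \<longlongrightarrow> 0) at_top"
      by (rule Lim_null_comparison[OF _ lim], rule always_eventually, rule allI)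
        (use bd in \<open>simp add: norm_minus_commute\<close>)
  qed
qed

text \<open>Variation of constants: the solution is the inverse oscillation times the primitive of
  \<open>osc \<kappa> x * H x\<close> that vanishes at infinity.\<close>

lemma osc_primitive:
  assumes H: "\<And>x. isCont H x"
    and \<Phi>: "\<And>x. (\<Phi> has_real_derivative \<Phi>' x) (at x)"
    and le: "\<And>x. norm (H x) \<le> - \<Phi>' x"
    and lim: "(\<Phi> \<longlongrightarrow> 0) at_top"
  obtains U where "\<And>x. (U has_vector_derivative H x - 2 * \<i> * of_real \<kappa> * U x) (at x)"
    "(U \<longlongrightarrow> 0) at_top"
proof -
  have "isCont (\<lambda>x. osc \<kappa> x * H x) x" for x
    using H by (intro continuous_intros)
  then obtain f where f: "\<And>x. (f has_vector_derivative osc \<kappa> x * H x) (at x)"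
      and f0: "(f \<longlongrightarrow> 0) at_top"
    by (rule antiderivative_vanishing_at_top[where \<Phi> = \<Phi> and \<Phi>' = \<Phi>'])
      (use \<Phi> le lim in \<open>auto simp: norm_mult\<close>)
  let ?e = "\<lambda>x. exp (x *\<^sub>R (- 2 * \<i> * complex_of_real \<kappa>))"
  have inv: "?e x * osc \<kappa> x = 1" for x
    by (simp flip: exp_add)
  show thesis
  proof
    fix x
    have "((\<lambda>x. ?e x * f x) has_vector_derivative
        ?e x * (osc \<kappa> x * H x) + ?e x * (- 2 * \<i> * complex_of_real \<kappa>) * f x) (at x)"
      by (rule has_vector_derivative_mult[OF exp_scaleR_has_vector_derivative_right f])
    then show "((\<lambda>x. ?e x * f x) has_vector_derivative
        H x - 2 * \<i> * of_real \<kappa> * (?e x * f x)) (at x)"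
      unfolding mult.assoc[symmetric] inv by (simp add: algebra_simps)
  next
    show "((\<lambda>x. ?e x * f x) \<longlongrightarrow> 0) at_top"
      using tendsto_osc_mult_0[OF f0, of "- \<kappa>"] by simp
  qed
qed

lemma has_vector_derivative_series:
  fixes f :: "nat \<Rightarrow> real \<Rightarrow> 'a::banach"
  assumes f: "\<And>n x. (f n has_vector_derivative f' n x) (at x)"
    and sum_f: "\<And>x. summable (\<lambda>n. f n x)"
    and cont: "\<And>x. isCont B x"
    and le: "\<And>n x. norm (f' n x) \<le> B x * (1 / 2) ^ n"
  shows "((\<lambda>x. \<Sum>n. f n x) has_vector_derivative (\<Sum>n. f' n x)) (at x)"
proof -
  \<comment> \<open>\<open>B\<close> is only locally bounded, so the Weierstrass test is applied on
    a bounded neighbourhood of \<open>x\<close>.\<close>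
  define S where "S = {x - 1 <..< x + 1}"
  have S: "open S" "convex S" "x \<in> S" by (auto simp: S_def)
  have "compact (B ` {x - 1..x + 1})"
    by (intro compact_continuous_image continuous_at_imp_continuous_on ballI cont compact_Icc)
  then obtain K where K: "\<And>y. y \<in> S \<Longrightarrow> B y \<le> K"
    using compact_imp_bounded[THEN bounded_imp_bdd_above] unfolding bdd_above_def S_def
    by (metis greaterThanLessThan_subseteq_atLeastAtMost_iff imageI order_refl subsetD)
  have le': "norm (f' n y) \<le> K * (1 / 2) ^ n" if "y \<in> S" for n y
    using le[of n y] K[OF that] by (smt (verit) mult_right_mono zero_le_power zero_le_divide_1_iff)
  have "uniform_limit S (\<lambda>n y. \<Sum>i<n. f' i y) (\<lambda>y. \<Sum>i. f' i y) sequentially"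
    by (rule Weierstrass_m_test[where M = "\<lambda>n. K * (1 / 2) ^ n"])
      (use le' in \<open>auto intro!: summable_mult summable_geometric\<close>)
  then have ul: "\<forall>\<^sub>F n in sequentially. \<forall>y\<in>S. norm ((\<Sum>i<n. f' i y) - (\<Sum>i. f' i y)) \<le> e"
    if "e > 0" for e
    using that unfolding uniform_limit_iff dist_norm
    by (auto elim!: allE[of _ e] eventually_mono intro: less_imp_le)
  have "\<exists>g. \<forall>y\<in>S. (\<lambda>n. f n y) sums g y \<and>
      (g has_derivative (\<lambda>h. h *\<^sub>R (\<Sum>i. f' i y))) (at y within S)"
  proof (rule has_derivative_series[OF S(2), where f' = "\<lambda>n y h. h *\<^sub>R f' n y"])
    show "(f n has_derivative (\<lambda>h. h *\<^sub>R f' n y)) (at y within S)" for n y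
      using f[of n y] unfolding has_vector_derivative_def by (rule has_derivative_at_withinI)
    show "\<forall>\<^sub>F n in sequentially. \<forall>y\<in>S. \<forall>h.
        norm ((\<Sum>i<n. h *\<^sub>R f' i y) - h *\<^sub>R (\<Sum>i. f' i y)) \<le> e * norm h" if "e > 0" for e
      using ul[OF that]
    proof eventually_elim
      case (elim n)
      have "norm ((\<Sum>i<n. h *\<^sub>R f' i y) - h *\<^sub>R (\<Sum>i. f' i y)) \<le> e * norm h" if "y \<in> S" for y h
      proof -
        have "norm ((\<Sum>i<n. h *\<^sub>R f' i y) - h *\<^sub>R (\<Sum>i. f' i y))
            = norm h * norm ((\<Sum>i<n. f' i y) - (\<Sum>i. f' i y))"
          by (simp flip: scaleR_sum_right scaleR_diff_right)
        also have "\<dots> \<le> e * norm h"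
          using elim that by (simp add: mult.commute[of e] mult_left_mono)
        finally show ?thesis .
      qed
      then show ?case by blast
    qed
  qed (use S sum_f in auto)
  then obtain g where g: "\<And>y. y \<in> S \<Longrightarrow> (\<lambda>n. f n y) sums g y"
      "\<And>y. y \<in> S \<Longrightarrow> (g has_derivative (\<lambda>h. h *\<^sub>R (\<Sum>i. f' i y))) (at y within S)"
    by blast
  have "(g has_vector_derivative (\<Sum>i. f' i x)) (at x)"
    using g(2)[OF S(3)] unfolding has_vector_derivative_def at_within_open[OF S(3,1)] .
  then show ?thesis
    by (rule has_vector_derivative_transform_within_open[OF _ S(1,3)])
      (rule sums_unique, rule g(1))
qed

section \<open>Weights and the integral equation\<close>

text \<open>The powers \<open>\<phi> = decay_base\<^sup>a\<close> behave like \<open>\<bar>x\<bar>\<^sup>a\<close> at \<open>-\<infinity>\<close> and like \<open>x\<^sup>-\<^sup>a\<close> at \<open>+\<infinity>\<close>, and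
  \<open>\<phi>'' \<ge> a (a - 1) \<phi> / (1 + x\<^sup>2)\<close>. Hence \<open>\<phi>'' \<ge> 2 \<bar>V\<bar> \<phi>\<close> for large \<open>a\<close>, which makes the integral
  equation a contraction by \<open>1/2\<close> in the norm weighted by \<open>\<phi>\<close>. Below, \<open>majorant a\<close> is \<open>\<phi>\<close>,
  \<open>majorant1 a\<close> is \<open>- \<phi>'\<close> and \<open>majorant2 a\<close> is \<open>\<phi>''\<close>.\<close>

definition decay_base :: "real \<Rightarrow> real" where
  "decay_base x = sqrt (1 + x\<^sup>2) - x"

definition majorant :: "nat \<Rightarrow> real \<Rightarrow> real" where
  "majorant a x = decay_base x ^ a"

definition majorant1 :: "nat \<Rightarrow> real \<Rightarrow> real" where
  "majorant1 a x = real a * decay_base x ^ a / sqrt (1 + x\<^sup>2)"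

definition majorant2 :: "nat \<Rightarrow> real \<Rightarrow> real" where
  "majorant2 a x = real a * decay_base x ^ a / (1 + x\<^sup>2) * (real a + x / sqrt (1 + x\<^sup>2))"

lemma one_plus_square_pos: "0 < 1 + (x::real)\<^sup>2"
  by (simp add: add_pos_nonneg)

lemma abs_less_sqrt: "\<bar>x\<bar> < sqrt (1 + x\<^sup>2)"
  by (rule real_less_rsqrt) simp

lemma decay_base_pos: "0 < decay_base x"
  using abs_less_sqrt[of x] by (simp add: decay_base_def)

text \<open>\<open>decay_base x\<close> equals exp (- arsinh x), so its logarithmic derivative is
  \<open>- 1 / sqrt (1 + x\<^sup>2)\<close>.\<close>

lemma decay_base_has_derivative:
  "(decay_base has_real_derivative - (decay_base x / sqrt (1 + x\<^sup>2))) (at x)"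
proof -
  have pos: "0 < 1 + x\<^sup>2" by (simp add: add_pos_nonneg)
  have s: "sqrt (1 + x\<^sup>2) \<noteq> 0" using pos by simp
  have "((\<lambda>x. sqrt (1 + x\<^sup>2) - x) has_real_derivative (inverse (sqrt (1 + x\<^sup>2)) / 2 * (2 * x) - 1)) (at x)"
    using pos by (auto intro!: derivative_eq_intros simp: power2_eq_square)
  moreover have "inverse (sqrt (1 + x\<^sup>2)) / 2 * (2 * x) - 1 = - (decay_base x / sqrt (1 + x\<^sup>2))"
    using s by (simp add: decay_base_def field_simps)
  ultimately show ?thesis by (simp add: decay_base_def[abs_def])
qed

lemma decay_base_power_has_derivative:
  "((\<lambda>x. decay_base x ^ a) has_real_derivative - majorant1 a x) (at x)"
proof (cases a)
  case (Suc b)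
  show ?thesis
    using DERIV_power[OF decay_base_has_derivative[of x], of a]
    by (simp add: majorant1_def Suc algebra_simps)
qed (simp add: majorant1_def)

lemma majorant_has_derivative:
  "(majorant a has_real_derivative - majorant1 a x) (at x)"
  using decay_base_power_has_derivative by (simp add: majorant_def[abs_def])

lemma majorant1_has_derivative:
  "(majorant1 a has_real_derivative - majorant2 a x) (at x)"
proof -
  have pos: "0 < 1 + x\<^sup>2" by (simp add: add_pos_nonneg)
  define s where "s = sqrt (1 + x\<^sup>2)"
  have s: "s > 0" "1 + x\<^sup>2 = s\<^sup>2" using pos by (auto simp: s_def)
  have "(sqrt has_real_derivative inverse s / 2) (at (1 + x\<^sup>2))"
    using DERIV_real_sqrt[OF pos] by (simp add: s_def)
  then have ds: "((\<lambda>x. sqrt (1 + x\<^sup>2)) has_real_derivative x / s) (at x)"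
    using pos by (auto intro!: derivative_eq_intros simp: power2_eq_square s_def field_simps)
  have "((\<lambda>x. real a * decay_base x ^ a / sqrt (1 + x\<^sup>2)) has_real_derivative
      (real a * (- majorant1 a x) * s - real a * decay_base x ^ a * (x / s)) / (s * s)) (at x)"
    using DERIV_divide[OF DERIV_cmult[OF decay_base_power_has_derivative[of a x], of "real a"] ds] s
    by (simp add: s_def[symmetric])
  moreover have "(real a * (- majorant1 a x) * s - real a * decay_base x ^ a * (x / s)) / (s * s)
      = - majorant2 a x"
    unfolding majorant1_def majorant2_def s_def[symmetric] s(2)
    using s by (simp add: field_simps power2_eq_square)
  ultimately show ?thesis by (simp add: majorant1_def[abs_def])
qed

lemma majorant_nonneg: "0 \<le> majorant a x" "0 \<le> majorant1 a x"
  using decay_base_pos[of x] by (auto simp: majorant_def majorant1_def)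

lemma majorant2_ge:
  assumes "1 \<le> a"
  shows "real a * (real a - 1) * majorant a x / (1 + x\<^sup>2) \<le> majorant2 a x"
proof -
  have "- 1 \<le> x / sqrt (1 + x\<^sup>2)"
    using abs_less_sqrt[of x] one_plus_square_pos[of x] by (subst pos_le_divide_eq) auto
  then have "real a - 1 \<le> real a + x / sqrt (1 + x\<^sup>2)" by simp
  then have "real a * decay_base x ^ a / (1 + x\<^sup>2) * (real a - 1) \<le> majorant2 a x"
    unfolding majorant2_def using decay_base_pos[of x]
    by (intro mult_left_mono) (auto intro!: divide_nonneg_nonneg simp: add_nonneg_nonneg)
  then show ?thesis by (simp add: majorant_def algebra_simps)
qed

lemma majorant2_nonneg: "0 \<le> majorant2 a x"
proof (cases "a = 0")
  case False
  then have "0 \<le> real a * (real a - 1) * majorant a x / (1 + x\<^sup>2)"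
    by (auto intro!: divide_nonneg_nonneg mult_nonneg_nonneg simp: majorant_nonneg add_nonneg_nonneg)
  with False majorant2_ge[of a x] show ?thesis by linarith
qed (simp add: majorant2_def)

lemma decay_base_eq: "decay_base x = 1 / (sqrt (1 + x\<^sup>2) + x)"
proof -
  have "(sqrt (1 + x\<^sup>2) - x) * (sqrt (1 + x\<^sup>2) + x) = 1"
    by (simp add: algebra_simps flip: power2_eq_square)
  then show ?thesis
    using abs_less_sqrt[of x] by (simp add: decay_base_def field_simps)
qed

lemma tendsto_majorant:
  assumes "1 \<le> a"
  shows "(majorant a \<longlongrightarrow> 0) at_top" "(majorant1 a \<longlongrightarrow> 0) at_top"
proof -
  have "filterlim (\<lambda>x. sqrt (1 + x\<^sup>2) + x) at_top at_top"
    by (rule filterlim_at_top_mono[OF filterlim_ident]) auto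
  then have "(decay_base \<longlongrightarrow> 0) at_top"
    unfolding decay_base_eq[abs_def]
    by (intro tendsto_divide_0 tendsto_const) (auto intro: filterlim_at_top_imp_at_infinity)
  from tendsto_power[OF this, of a] show m: "(majorant a \<longlongrightarrow> 0) at_top"
    using assms by (simp add: majorant_def[abs_def] power_0_left)
  have "((\<lambda>x. real a * majorant a x) \<longlongrightarrow> 0) at_top"
    using tendsto_mult_left[OF m, of "real a"] by simp
  then show "(majorant1 a \<longlongrightarrow> 0) at_top"
  proof (rule Lim_null_comparison[rotated], intro always_eventually allI)
    fix x :: real
    have "1 \<le> sqrt (1 + x\<^sup>2)" by simp
    then have "real a * majorant a x / sqrt (1 + x\<^sup>2) \<le> real a * majorant a x / 1"
      using majorant_nonneg[of a x] one_plus_square_pos[of x] by (intro divide_left_mono) auto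
    then show "norm (majorant1 a x) \<le> real a * majorant a x"
      using majorant_nonneg[of a x] by (simp add: majorant1_def majorant_def)
  qed
qed

section \<open>Polynomial weights and tame families\<close>

definition wt :: "real \<Rightarrow> real" where
  "wt x = 1 + max 0 x"

lemma wt_ge_1: "1 \<le> wt x"
  by (simp add: wt_def)

lemma wt_pos [simp]: "0 < wt x" "0 \<le> wt x" "wt x \<noteq> 0"
  using wt_ge_1[of x] by auto

text \<open>One of the two factors is always 1, so powers of \<open>wt x\<close> and
  \<open>wt (- x)\<close> prescribe the behaviour at the two ends of the line independently.\<close>

lemma wt_mult_neg: "wt x * wt (- x) = 1 + \<bar>x\<bar>"
  by (simp add: wt_def max_def)

lemma one_plus_square_le: "1 + x\<^sup>2 \<le> (wt x * wt (- x))\<^sup>2"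
  unfolding wt_mult_neg by (simp add: power2_eq_square algebra_simps)

text \<open>Turns bounds by weights into bounds by majorants; \<open>decay_base_le\<close> serves
  the way back.\<close>

lemma decay_base_ge: "wt (- x) / (2 * wt x) \<le> decay_base x"
proof (cases "0 \<le> x")
  case True
  have "sqrt (1 + x\<^sup>2) \<le> 1 + x"
    using True by (intro real_le_lsqrt) (auto simp: power2_eq_square algebra_simps)
  then have "1 / (2 * (1 + x)) \<le> decay_base x"
    unfolding decay_base_eq using True abs_less_sqrt[of x] by (intro divide_left_mono) auto
  then show ?thesis using True by (simp add: wt_def)
next
  case False
  have "(1 - x) / 2 \<le> 1 - x" using False by simp
  also have "\<dots> \<le> decay_base x" by (simp add: decay_base_def)
  finally have "(1 - x) / 2 \<le> decay_base x" .
  then show ?thesis using False by (simp add: wt_def)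
qed

lemma decay_base_le: "decay_base x \<le> 2 * wt (- x)"
proof -
  have "sqrt (1 + x\<^sup>2) \<le> 1 + \<bar>x\<bar>"
    by (intro real_le_lsqrt) (auto simp: power2_eq_square algebra_simps)
  then show ?thesis
    by (auto simp: decay_base_def wt_def max_def)
qed

text \<open>Rapid decay at \<open>+\<infinity>\<close>, and growth of order \<open>c - 2\<close> at \<open>-\<infinity>\<close>, uniformly in the index. The
  shift by \<open>2\<close> makes room for integrability at \<open>-\<infinity>\<close> at \<open>c = 0\<close> without negative exponents.\<close>

definition tame :: "'i set \<Rightarrow> nat \<Rightarrow> ('i \<Rightarrow> real \<Rightarrow> complex) \<Rightarrow> bool" where
  "tame I c g \<longleftrightarrow> (\<forall>N. \<exists>C. \<forall>i\<in>I. \<forall>x. norm (g i x) * wt x ^ N * (wt (- x))\<^sup>2 \<le> C * wt (- x) ^ c)"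

lemma tameI:
  assumes "\<And>N. \<exists>C. \<forall>i\<in>I. \<forall>x. norm (g i x) * wt x ^ N * (wt (- x))\<^sup>2 \<le> C * wt (- x) ^ c"
  shows "tame I c g"
  using assms by (simp add: tame_def)

lemma tameE:
  assumes "tame I c g"
  obtains C where "0 \<le> C"
    "\<And>i x. i \<in> I \<Longrightarrow> norm (g i x) * wt x ^ N * (wt (- x))\<^sup>2 \<le> C * wt (- x) ^ c"
proof -
  obtain C where C: "\<And>i x. i \<in> I \<Longrightarrow> norm (g i x) * wt x ^ N * (wt (- x))\<^sup>2 \<le> C * wt (- x) ^ c"
    using assms unfolding tame_def by blast
  show thesis
  proof
    show "norm (g i x) * wt x ^ N * (wt (- x))\<^sup>2 \<le> \<bar>C\<bar> * wt (- x) ^ c" if "i \<in> I" for i x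
      using C[OF that, of x] by (smt (verit) mult_right_mono wt_pos zero_le_power)
  qed simp
qed

lemma tame_bound:
  assumes "tame I c g"
  obtains C where "0 \<le> C" "\<And>i x. i \<in> I \<Longrightarrow> norm (g i x) \<le> C * wt (- x) ^ c"
proof -
  obtain C where C: "0 \<le> C"
    "\<And>i x. i \<in> I \<Longrightarrow> norm (g i x) * wt x ^ 0 * (wt (- x))\<^sup>2 \<le> C * wt (- x) ^ c"
    using assms by (rule tameE[where N = 0]) blast
  have "norm (g i x) * 1 \<le> norm (g i x) * (wt (- x))\<^sup>2" for i x
    using wt_ge_1 by (intro mult_left_mono one_le_power) auto
  then have "norm (g i x) \<le> C * wt (- x) ^ c" if "i \<in> I" for i x
    using C(2)[OF that, of x] order_trans by fastforce
  with C(1) show thesis by (rule that)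
qed

lemma tame_le_majorant2:
  assumes "tame I c g" "c \<le> a" "2 \<le> a"
  obtains K where "0 \<le> K" "\<And>i x. i \<in> I \<Longrightarrow> norm (g i x) \<le> K * majorant2 a x"
proof -
  \<comment> \<open>Of the \<open>a + 2\<close> powers of \<open>wt x\<close>, \<open>a\<close>
    match the decay of \<open>majorant a\<close> at the right end and two supply the factor
    \<open>1 / (1 + x\<^sup>2)\<close>. At the left end that factor comes from the square of
    \<open>wt (- x)\<close> built into \<open>tame\<close>.\<close>
  obtain C where C: "0 \<le> C"
    "\<And>i x. i \<in> I \<Longrightarrow> norm (g i x) * wt x ^ (a + 2) * (wt (- x))\<^sup>2 \<le> C * wt (- x) ^ c"
    using assms(1) by (rule tameE[where N = "a + 2"]) blast
  show thesis
  proof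
    show "0 \<le> C * 2 ^ a" using C by simp
    fix i x assume i: "i \<in> I"
    define p q where "p = wt x" and "q = wt (- x)"
    have pq: "p > 0" "q > 0" "1 \<le> q" by (auto simp: p_def q_def wt_ge_1)
    have "norm (g i x) * p ^ (a + 2) * q\<^sup>2 \<le> C * q ^ c"
      using C(2)[OF i] by (simp add: p_def q_def)
    also have "\<dots> \<le> C * q ^ a"
      using C(1) assms(2) pq by (intro mult_left_mono power_increasing) auto
    finally have "norm (g i x) \<le> C * q ^ a / (p ^ (a + 2) * q\<^sup>2)"
      using pq by (simp add: field_simps)
    also have "\<dots> = C * 2 ^ a * ((q / (2 * p)) ^ a / (p * q)\<^sup>2)"
      using pq by (simp add: field_simps power_add power2_eq_square)
    also have "\<dots> \<le> C * 2 ^ a * (1 * majorant a x / (1 + x\<^sup>2))"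
    proof (intro mult_left_mono frac_le)
      show "(q / (2 * p)) ^ a \<le> 1 * majorant a x"
        using decay_base_ge[of x] pq by (simp add: majorant_def p_def q_def power_mono)
      show "1 + x\<^sup>2 \<le> (p * q)\<^sup>2" using one_plus_square_le by (simp add: p_def q_def)
      show "0 < 1 + x\<^sup>2" by (simp add: add_pos_nonneg)
    qed (use C majorant_nonneg in auto)
    also have "\<dots> \<le> C * 2 ^ a * (real a * (real a - 1) * majorant a x / (1 + x\<^sup>2))"
    proof (intro mult_left_mono divide_right_mono mult_right_mono)
      have "real 2 * (real 2 - 1) \<le> real a * (real a - 1)"
        using assms(3) by (intro mult_mono) auto
      then show "1 \<le> real a * (real a - 1)" by simp
    qed (use C majorant_nonneg in \<open>auto simp: add_nonneg_nonneg\<close>)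
    also have "\<dots> \<le> C * 2 ^ a * majorant2 a x"
      using C assms(3) by (intro mult_left_mono majorant2_ge) auto
    finally show "norm (g i x) \<le> C * 2 ^ a * majorant2 a x" .
  qed
qed

lemma tame_mono:
  assumes "tame I c g" "c \<le> d"
  shows "tame I d g"
proof (rule tameI)
  fix N
  obtain C where C: "0 \<le> C"
    "\<And>i x. i \<in> I \<Longrightarrow> norm (g i x) * wt x ^ N * (wt (- x))\<^sup>2 \<le> C * wt (- x) ^ c"
    using assms(1) by (rule tameE[where N = N]) blast
  have "C * wt (- x) ^ c \<le> C * wt (- x) ^ d" for x
    using C(1) assms(2) wt_ge_1 by (intro mult_left_mono power_increasing) auto
  then show "\<exists>C. \<forall>i\<in>I. \<forall>x. norm (g i x) * wt x ^ N * (wt (- x))\<^sup>2 \<le> C * wt (- x) ^ d"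
    using C(2) order_trans by blast
qed

lemma tame_add:
  assumes "tame I c g" "tame I c h"
  shows "tame I c (\<lambda>i x. g i x + h i x)"
proof (rule tameI)
  fix N
  obtain C where C: "\<And>i x. i \<in> I \<Longrightarrow> norm (g i x) * wt x ^ N * (wt (- x))\<^sup>2 \<le> C * wt (- x) ^ c"
    using assms(1) by (rule tameE[where N = N]) blast
  obtain D where D: "\<And>i x. i \<in> I \<Longrightarrow> norm (h i x) * wt x ^ N * (wt (- x))\<^sup>2 \<le> D * wt (- x) ^ c"
    using assms(2) by (rule tameE[where N = N]) blast
  have "norm (g i x + h i x) * wt x ^ N * (wt (- x))\<^sup>2 \<le> (C + D) * wt (- x) ^ c" if "i \<in> I" for i x
  proof -
    have "norm (g i x + h i x) * (wt x ^ N * (wt (- x))\<^sup>2)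
        \<le> (norm (g i x) + norm (h i x)) * (wt x ^ N * (wt (- x))\<^sup>2)"
      by (intro mult_right_mono norm_triangle_ineq) auto
    with C[OF that, of x] D[OF that, of x] show ?thesis by (simp add: algebra_simps)
  qed
  then show "\<exists>C. \<forall>i\<in>I. \<forall>x. norm (g i x + h i x) * wt x ^ N * (wt (- x))\<^sup>2 \<le> C * wt (- x) ^ c"
    by blast
qed

lemma tame_cmult:
  assumes "tame I c g"
  shows "tame I c (\<lambda>i x. a * g i x)"
proof (rule tameI)
  fix N
  obtain C where C: "\<And>i x. i \<in> I \<Longrightarrow> norm (g i x) * wt x ^ N * (wt (- x))\<^sup>2 \<le> C * wt (- x) ^ c"
    using assms(1) by (rule tameE[where N = N]) blast
  have "norm (a * g i x) * wt x ^ N * (wt (- x))\<^sup>2 \<le> (norm a * C) * wt (- x) ^ c"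
    if "i \<in> I" for i x
    using mult_left_mono[OF C[OF that, of x], of "norm a"] by (simp add: norm_mult algebra_simps)
  then show "\<exists>C. \<forall>i\<in>I. \<forall>x. norm (a * g i x) * wt x ^ N * (wt (- x))\<^sup>2 \<le> C * wt (- x) ^ c"
    by blast
qed

section \<open>Schwartz potentials and their domination by the majorants\<close>

locale schwartz_potential =
  fixes V :: "real \<Rightarrow> real"
  assumes V: "schwartz V"
begin

lemma V_has_derivative:
  "((deriv ^^ j) V has_real_derivative (deriv ^^ Suc j) V x) (at x)"
  using V unfolding schwartz_def by (auto intro!: field_differentiable_derivI)

lemma V_rapid_decay:
  obtains C where "0 \<le> C" "\<And>x. \<bar>(deriv ^^ j) V x\<bar> * (1 + \<bar>x\<bar>) ^ N \<le> C"
proof -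
  have b: "bounded (range (\<lambda>x. x ^ m * (deriv ^^ j) V x))" for m
    using V unfolding schwartz_def by blast
  obtain C0 where C0: "\<And>x. \<bar>x ^ 0 * (deriv ^^ j) V x\<bar> \<le> C0"
    using b[of 0] unfolding bounded_iff by auto
  obtain C1 where C1: "\<And>x. \<bar>x ^ N * (deriv ^^ j) V x\<bar> \<le> C1"
    using b[of N] unfolding bounded_iff by auto
  have *: "\<bar>(deriv ^^ j) V x\<bar> * (1 + \<bar>x\<bar>) ^ N \<le> 2 ^ N * (C0 + C1)" for x
  proof -
    have "(1 + \<bar>x\<bar>) ^ N \<le> 2 ^ N * (1 + \<bar>x\<bar> ^ N)"
    proof (cases "\<bar>x\<bar> \<le> 1")
      case True
      then have "(1 + \<bar>x\<bar>) ^ N \<le> 2 ^ N" by (intro power_mono) auto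
      also have "\<dots> \<le> 2 ^ N * (1 + \<bar>x\<bar> ^ N)" by simp
      finally show ?thesis .
    next
      case False
      then have "(1 + \<bar>x\<bar>) ^ N \<le> (2 * \<bar>x\<bar>) ^ N" by (intro power_mono) auto
      also have "\<dots> \<le> 2 ^ N * (1 + \<bar>x\<bar> ^ N)" by (simp add: power_mult_distrib)
      finally show ?thesis .
    qed
    then have "\<bar>(deriv ^^ j) V x\<bar> * (1 + \<bar>x\<bar>) ^ N \<le> \<bar>(deriv ^^ j) V x\<bar> * (2 ^ N * (1 + \<bar>x\<bar> ^ N))"
      by (intro mult_left_mono) auto
    also have "\<dots> = 2 ^ N * (\<bar>x ^ 0 * (deriv ^^ j) V x\<bar> + \<bar>x ^ N * (deriv ^^ j) V x\<bar>)"
      by (simp add: abs_mult power_abs algebra_simps)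
    also have "\<dots> \<le> 2 ^ N * (C0 + C1)"
      using C0[of x] C1[of x] by (intro mult_left_mono add_mono) auto
    finally show ?thesis .
  qed
  moreover have "0 \<le> 2 ^ N * (C0 + C1)"
    by (rule order_trans[OF _ *[of 0]]) simp
  ultimately show thesis using that by blast
qed

text \<open>Rapid decay of the derivatives of \<open>V\<close> absorbs any power \<open>a\<close>,
  so the resulting order is 0 and \<open>a\<close> is forgotten. This is what turns a crude bound on
  a solution into a sharp one.\<close>

lemma tame_V_mult_growth:
  assumes g: "\<And>i x. i \<in> I \<Longrightarrow> norm (g i x) \<le> C * wt (- x) ^ a"
  shows "tame I 0 (\<lambda>i x. of_real ((deriv ^^ j) V x) * g i x)"
proof (rule tameI)
  fix N
  obtain D where D: "0 \<le> D" "\<And>x. \<bar>(deriv ^^ j) V x\<bar> * (1 + \<bar>x\<bar>) ^ (a + N + 2) \<le> D"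
    by (rule V_rapid_decay[of j "a + N + 2"]) blast
  have "norm (of_real ((deriv ^^ j) V x) * g i x) * wt x ^ N * (wt (- x))\<^sup>2 \<le> \<bar>C\<bar> * D * wt (- x) ^ 0"
    if "i \<in> I" for i x
  proof -
    have "norm (g i x) \<le> \<bar>C\<bar> * wt (- x) ^ a"
      using g[OF that, of x] by (rule order_trans) (intro mult_right_mono, auto)
    then have "norm (of_real ((deriv ^^ j) V x) * g i x) * (wt x ^ N * (wt (- x))\<^sup>2)
        \<le> \<bar>(deriv ^^ j) V x\<bar> * (\<bar>C\<bar> * wt (- x) ^ a) * (wt x ^ N * (wt (- x))\<^sup>2)"
      by (auto simp: norm_mult intro!: mult_right_mono mult_left_mono)
    also have "\<dots> = \<bar>C\<bar> * (\<bar>(deriv ^^ j) V x\<bar> * (wt (- x) ^ a * wt x ^ N * (wt (- x))\<^sup>2))"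
      by (simp only: ac_simps)
    also have "\<dots> \<le> \<bar>C\<bar> * (\<bar>(deriv ^^ j) V x\<bar> * ((1 + \<bar>x\<bar>) ^ a * (1 + \<bar>x\<bar>) ^ N * (1 + \<bar>x\<bar>)\<^sup>2))"
      by (intro mult_left_mono mult_mono power_mono) (auto simp: wt_def)
    also have "\<dots> \<le> \<bar>C\<bar> * D"
      using D(2)[of x] by (intro mult_left_mono) (auto simp: power_add power2_eq_square ac_simps)
    finally show ?thesis by (simp add: mult.assoc)
  qed
  then show "\<exists>C. \<forall>i\<in>I. \<forall>x. norm (of_real ((deriv ^^ j) V x) * g i x) * wt x ^ N * (wt (- x))\<^sup>2
      \<le> C * wt (- x) ^ 0"
    by blast
qed

lemma tame_V_mult:
  assumes "tame I c g"
  shows "tame I 0 (\<lambda>i x. of_real ((deriv ^^ j) V x) * g i x)"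
proof -
  obtain C where "\<And>i x. i \<in> I \<Longrightarrow> norm (g i x) \<le> C * wt (- x) ^ c"
    using assms by (rule tame_bound) blast
  then show ?thesis by (rule tame_V_mult_growth)
qed

lemma tame_V: "tame I 0 (\<lambda>i x. of_real ((deriv ^^ j) V x))"
  using tame_V_mult_growth[of I "\<lambda>_ _. 1" 1 0 j] by simp

lemma isCont_V: "isCont V x"
  using V_has_derivative[of 0 x] by (auto intro: DERIV_isCont)

lemma V_majorant:
  obtains a0 where "2 \<le> a0" "\<And>a x. a0 \<le> a \<Longrightarrow> \<bar>V x\<bar> * majorant a x \<le> majorant2 a x / 2"
proof -
  obtain A where A: "0 \<le> A" "\<And>x. \<bar>V x\<bar> * (1 + \<bar>x\<bar>)\<^sup>2 \<le> A"
    using V_rapid_decay[of 0 2] by auto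
  \<comment> \<open>\<open>A\<close> bounds \<open>\<bar>V x\<bar> * (1 + x\<^sup>2)\<close>. From
    \<open>real a - 1 \<ge> 2 * A\<close> and \<open>a \<ge> 1\<close> it follows that
    \<open>real a * (real a - 1) / 2\<close> is at least \<open>A\<close>.\<close>
  define a0 where "a0 = nat \<lceil>2 * A\<rceil> + 2"
  show thesis
  proof
    fix a and x :: real assume a: "a0 \<le> a"
    have a1: "2 * A \<le> real a - 1" "1 \<le> real a - 1"
      using a by (auto simp: a0_def) linarith+
    have "2 * A * 1 \<le> real a * (real a - 1)"
      using a1 A by (subst mult.commute) (intro mult_mono, auto)
    then have A2: "A \<le> real a * (real a - 1) / 2" by simp
    have pos: "0 < 1 + x\<^sup>2" by (simp add: add_pos_nonneg)
    have "\<bar>V x\<bar> * (1 + x\<^sup>2) \<le> \<bar>V x\<bar> * (1 + \<bar>x\<bar>)\<^sup>2"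
      by (intro mult_left_mono) (auto simp: power2_eq_square algebra_simps)
    also have "\<dots> \<le> real a * (real a - 1) / 2" using A(2)[of x] A2 by linarith
    finally have "\<bar>V x\<bar> \<le> real a * (real a - 1) / 2 / (1 + x\<^sup>2)"
      using pos by (simp add: field_simps)
    then have "\<bar>V x\<bar> * majorant a x \<le> real a * (real a - 1) / 2 / (1 + x\<^sup>2) * majorant a x"
      using majorant_nonneg[of a x] by (intro mult_right_mono)
    also have "\<dots> = real a * (real a - 1) * majorant a x / (1 + x\<^sup>2) / 2"
      by simp
    also have "\<dots> \<le> majorant2 a x / 2"
      using majorant2_ge[of a x] a1 by (intro divide_right_mono) auto
    finally show "\<bar>V x\<bar> * majorant a x \<le> majorant2 a x / 2" .
  qed (simp add: a0_def)
qed

section \<open>A priori bound and existence of decaying solutions\<close>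

definition decaying_solution ::
  "real \<Rightarrow> (real \<Rightarrow> complex) \<Rightarrow> (real \<Rightarrow> complex) \<Rightarrow> (real \<Rightarrow> complex) \<Rightarrow> bool" where
  "decaying_solution \<kappa> S F U \<longleftrightarrow>
     (\<forall>x. (F has_vector_derivative U x) (at x)) \<and>
     (\<forall>x. (U has_vector_derivative of_real (V x) * F x + S x - 2 * \<i> * of_real \<kappa> * U x) (at x)) \<and>
     (F \<longlongrightarrow> 0) at_top \<and> (U \<longlongrightarrow> 0) at_top"

text \<open>Two integrations from infinity: from \<open>majorant2\<close> to
  \<open>majorant1\<close> with the oscillating factor, then to \<open>majorant\<close> without it.
  The hypothesis concerns a half line because a decaying solution is bounded a priori only on
  intervals unbounded to the right.\<close>

lemma decaying_solution_le_majorant: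
  assumes sol: "decaying_solution \<kappa> S F U" and "1 \<le> a"
    and le: "\<And>x. x0 \<le> x \<Longrightarrow> norm (of_real (V x) * F x + S x) \<le> M * majorant2 a x"
    and "x0 \<le> x"
  shows "norm (F x) \<le> M * majorant a x"
proof -
  have lim: "((\<lambda>x. M * majorant a x) \<longlongrightarrow> 0) at_top" "((\<lambda>x. M * majorant1 a x) \<longlongrightarrow> 0) at_top"
    using tendsto_mult_left[OF tendsto_majorant(1), of a M] tendsto_mult_left[OF tendsto_majorant(2), of a M]
      \<open>1 \<le> a\<close> by simp_all
  have d1: "((\<lambda>x. M * majorant a x) has_real_derivative - (M * majorant1 a x)) (at x)" for x
    using DERIV_cmult[OF majorant_has_derivative, of M a x] by simp
  have d2: "((\<lambda>x. M * majorant1 a x) has_real_derivative - (M * majorant2 a x)) (at x)" for x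
    using DERIV_cmult[OF majorant1_has_derivative, of M a x] by simp
  have U: "norm (U y) \<le> M * majorant1 a y" if "x0 \<le> y" for y
    by (rule osc_tail_bound[where \<kappa> = \<kappa> and H = "\<lambda>x. of_real (V x) * F x + S x", OF _ d2 _ _ lim(2)])
      (use sol le that in \<open>auto simp: decaying_solution_def\<close>)
  show ?thesis
    by (rule tail_bound[where f' = U, OF _ d1 _ _ lim(1)])
      (use sol U \<open>x0 \<le> x\<close> in \<open>auto simp: decaying_solution_def\<close>)
qed

text \<open>Bounding \<open>F\<close> by a multiple \<open>M\<close> of the majorant on a half line and inserting this into
  the equation replaces \<open>M\<close> by \<open>M / 2 + K\<close>.\<close>

lemma decaying_solution_bound:
  assumes sol: "decaying_solution \<kappa> S F U" and a: "2 \<le> a"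
    and small: "\<And>x. \<bar>V x\<bar> * majorant a x \<le> majorant2 a x / 2"
    and K: "0 \<le> K" and S: "\<And>x. norm (S x) \<le> K * majorant2 a x"
  shows "norm (F x) \<le> 2 * K * majorant a x"
proof -
  have contF: "continuous_on UNIV F"
    using sol unfolding decaying_solution_def
    by (meson continuous_at_imp_continuous_on has_vector_derivative_continuous)
  \<comment> \<open>Continuity and the limit at infinity bound \<open>F\<close> on the half line
    from \<open>x\<close>. The resulting constants \<open>B\<close> and \<open>L\<close> only enter
    the starting value of the iteration below, which removes them.\<close>
  obtain Z where Z: "\<And>y. Z \<le> y \<Longrightarrow> norm (F y) < 1"
    using sol tendstoD[of F 0 at_top 1] unfolding decaying_solution_def eventually_at_top_linorder
    by auto
  have "bounded (F ` {x..Z})"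
    by (intro compact_imp_bounded compact_continuous_image continuous_on_subset[OF contF]) auto
  then obtain B0 where B0: "\<forall>y\<in>{x..Z}. norm (F y) \<le> B0"
    unfolding bounded_iff by auto
  define B where "B = max 1 B0"
  have B: "norm (F y) \<le> B" if "x \<le> y" for y
    using that Z[of y] B0 by (cases "Z \<le> y") (auto simp: B_def le_max_iff_disj)
  obtain L where L: "0 \<le> L" "\<And>y. \<bar>V y\<bar> \<le> L * majorant2 a y"
    using tame_le_majorant2[OF tame_V[of UNIV 0], of a] a by auto
  have M0: "norm (F y) \<le> (B * L + K) * majorant a y" if "x \<le> y" for y
  proof (rule decaying_solution_le_majorant[OF sol _ _ that])
    fix z assume z: "x \<le> z"
    have "norm (of_real (V z) * F z + S z) \<le> \<bar>V z\<bar> * norm (F z) + norm (S z)"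
      by (rule order_trans[OF norm_triangle_ineq]) (simp add: norm_mult)
    also have "\<dots> \<le> (L * majorant2 a z) * B + K * majorant2 a z"
      using L B[OF z] S majorant2_nonneg by (intro add_mono mult_mono) auto
    finally show "norm (of_real (V z) * F z + S z) \<le> (B * L + K) * majorant2 a z"
      by (simp add: algebra_simps)
  qed (use a in simp)
  \<comment> \<open>The map from M to M / 2 + K has the fixed point 2 K, and the distance to it
    halves at each step.\<close>
  have step: "norm (F y) \<le> (B * L * (1 / 2) ^ n + 2 * K) * majorant a y" if "x \<le> y" for n y
    using that
  proof (induction n arbitrary: y)
    case 0
    have "(B * L + K) * majorant a y \<le> (B * L + 2 * K) * majorant a y"
      using majorant_nonneg K by (intro mult_right_mono) auto
    with M0[OF 0] show ?case by simp
  next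
    case (Suc n)
    let ?M = "B * L * (1 / 2) ^ n + 2 * K"
    have "norm (F y) \<le> (?M / 2 + K) * majorant a y"
    proof (rule decaying_solution_le_majorant[OF sol _ _ Suc.prems])
      fix z assume z: "x \<le> z"
      have M: "0 \<le> ?M" using K L(1) by (simp add: B_def)
      have "norm (of_real (V z) * F z + S z) \<le> \<bar>V z\<bar> * norm (F z) + norm (S z)"
        by (rule order_trans[OF norm_triangle_ineq]) (simp add: norm_mult)
      also have "\<dots> \<le> \<bar>V z\<bar> * (?M * majorant a z) + K * majorant2 a z"
        using S Suc.IH[OF z] by (intro add_mono mult_left_mono) auto
      also have "\<bar>V z\<bar> * (?M * majorant a z) \<le> ?M * (majorant2 a z / 2)"
        using mult_left_mono[OF small[of z] M] by (simp only: ac_simps)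
      finally show "norm (of_real (V z) * F z + S z) \<le> (?M / 2 + K) * majorant2 a z"
        by (simp add: algebra_simps add_divide_distrib)
    qed (use a in simp)
    then show ?case by (simp add: algebra_simps add_divide_distrib)
  qed
  have "(\<lambda>n. (B * L * (1 / 2) ^ n + 2 * K) * majorant a x) \<longlonglongrightarrow> (B * L * 0 + 2 * K) * majorant a x"
    by (intro tendsto_intros LIMSEQ_realpow_zero) auto
  then have "(\<lambda>n. (B * L * (1 / 2) ^ n + 2 * K) * majorant a x) \<longlonglongrightarrow> 2 * K * majorant a x"
    by simp
  then show ?thesis
    by (rule LIMSEQ_le_const) (use step in auto)
qed

text \<open>A Neumann series in the potential, geometrically convergent in the norm weighted by
  \<open>majorant a\<close>.\<close>

lemma decaying_solution_exists:
  assumes S: "tame UNIV c (\<lambda>_::unit. S)" and contS: "\<And>x. isCont S x"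
  obtains F U where "decaying_solution \<kappa> S F U"
proof -
  obtain a0 where a0: "2 \<le> a0" "\<And>a x. a0 \<le> a \<Longrightarrow> \<bar>V x\<bar> * majorant a x \<le> majorant2 a x / 2"
    by (rule V_majorant) blast
  define a where "a = max a0 c"
  have a: "a0 \<le> a" "c \<le> a" "2 \<le> a" using a0 by (auto simp: a_def)
  obtain K where K: "0 \<le> K" "\<And>x. norm (S x) \<le> K * majorant2 a x"
    using tame_le_majorant2[OF S a(2,3)] by auto
  \<comment> \<open>A term of the series: \<open>f\<close>, with derivative \<open>u\<close>, solves
    the equation without potential and with source \<open>g\<close>, and all three obey the
    geometric bounds.\<close>
  define P where "P n t = (case t of (g, f, u) \<Rightarrow>
      (n = 0 \<longrightarrow> g = S) \<and> (\<forall>x. norm (f x) \<le> K * (1 / 2) ^ n * majorant a x) \<and>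
      (\<forall>x. norm (u x) \<le> K * (1 / 2) ^ n * majorant1 a x) \<and>
      (\<forall>x. norm (g x) \<le> K * (1 / 2) ^ n * majorant2 a x) \<and>
      (\<forall>x. (f has_vector_derivative u x) (at x)) \<and>
      (\<forall>x. (u has_vector_derivative g x - 2 * \<i> * of_real \<kappa> * u x) (at x)))"
    for n :: nat and t :: "(real \<Rightarrow> complex) \<times> (real \<Rightarrow> complex) \<times> (real \<Rightarrow> complex)"
  have ex: "\<exists>f u. P n (g, f, u)"
    if g: "\<And>x. isCont g x" "\<And>x. norm (g x) \<le> K * (1 / 2) ^ n * majorant2 a x" "n = 0 \<longrightarrow> g = S"
    for g n
  proof -
    let ?M = "K * (1 / 2) ^ n"
    have lim: "((\<lambda>x. ?M * majorant a x) \<longlongrightarrow> 0) at_top" "((\<lambda>x. ?M * majorant1 a x) \<longlongrightarrow> 0) at_top"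
      using tendsto_mult_left[OF tendsto_majorant(1), of a ?M]
        tendsto_mult_left[OF tendsto_majorant(2), of a ?M] a by simp_all
    have d1: "((\<lambda>x. ?M * majorant a x) has_real_derivative - (?M * majorant1 a x)) (at x)" for x
      using DERIV_cmult[OF majorant_has_derivative, of ?M a x] by simp
    have d2: "((\<lambda>x. ?M * majorant1 a x) has_real_derivative - (?M * majorant2 a x)) (at x)" for x
      using DERIV_cmult[OF majorant1_has_derivative, of ?M a x] by simp
    obtain u where u: "\<And>x. (u has_vector_derivative g x - 2 * \<i> * of_real \<kappa> * u x) (at x)"
        "(u \<longlongrightarrow> 0) at_top"
      by (rule osc_primitive[OF g(1) d2 _ lim(2)]) (use g(2) in auto)
    have ub: "norm (u x) \<le> ?M * majorant1 a x" for x
      by (rule osc_tail_bound[OF u(1) d2 _ u(2) lim(2)]) (use g(2) in auto)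
    have "isCont u x" for x using u(1) by (rule has_vector_derivative_continuous)
    then obtain f where f: "\<And>x. (f has_vector_derivative u x) (at x)" "(f \<longlongrightarrow> 0) at_top"
      by (rule antiderivative_vanishing_at_top[OF _ d1 _ lim(1)]) (use ub in auto)
    have "norm (f x) \<le> ?M * majorant a x" for x
      by (rule tail_bound[OF f(1) d1 _ f(2) lim(1)]) (use ub in auto)
    with u f ub g have "P n (g, f, u)" by (simp add: P_def)
    then show ?thesis by blast
  qed
  \<comment> \<open>Each term comes from an existence statement, so the sequence needs dependent
    choice; the relation makes V times one term the source of the next.\<close>
  have "\<exists>t. \<forall>n. P n (t n) \<and> fst (t (Suc n)) = (\<lambda>x. of_real (V x) * fst (snd (t n)) x)"
  proof (rule dependent_nat_choice)
    show "\<exists>t. P 0 t" using ex[of S 0] contS K(2) by auto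
    fix t n assume "P n t"
    then obtain g f u where t: "t = (g, f, u)" and Pn: "P n (g, f, u)" by (cases t) auto
    have fb: "norm (f x) \<le> K * (1 / 2) ^ n * majorant a x" and "(f has_vector_derivative u x) (at x)" for x
      using Pn by (auto simp: P_def)
    then have "isCont f x" for x by (auto intro: has_vector_derivative_continuous)
    then have c: "isCont (\<lambda>x. of_real (V x) * f x) x" for x
      using isCont_V[of x] by (intro continuous_intros)
    have b: "norm (of_real (V x) * f x) \<le> K * (1 / 2) ^ Suc n * majorant2 a x" for x
    proof -
      have "norm (of_real (V x) * f x) \<le> \<bar>V x\<bar> * (K * (1 / 2) ^ n * majorant a x)"
        using fb by (auto simp: norm_mult intro: mult_left_mono)
      also have "\<dots> \<le> K * (1 / 2) ^ n * (majorant2 a x / 2)"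
        using mult_left_mono[OF a0(2)[OF a(1), of x], of "K * (1 / 2) ^ n"] K(1)
        by (simp add: ac_simps)
      finally show ?thesis by simp
    qed
    have "\<exists>f' u'. P (Suc n) (\<lambda>x. of_real (V x) * f x, f', u')"
      by (rule ex) (use b c in auto)
    then show "\<exists>y. P (Suc n) y \<and> fst y = (\<lambda>x. of_real (V x) * fst (snd t) x)"
      by (auto simp: t)
  qed
  then obtain t where tP: "\<And>n. P n (t n)"
    and tS: "\<And>n. fst (t (Suc n)) = (\<lambda>x. of_real (V x) * fst (snd (t n)) x)" by blast
  define g f u where "g n = fst (t n)" and "f n = fst (snd (t n))" and "u n = snd (snd (t n))" for n
  have "P n (g n, f n, u n)" for n using tP[of n] by (simp add: g_def f_def u_def)
  then have g0: "g 0 = S" and fb: "\<And>n x. norm (f n x) \<le> K * (1 / 2) ^ n * majorant a x"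
    and ub: "\<And>n x. norm (u n x) \<le> K * (1 / 2) ^ n * majorant1 a x"
    and gb: "\<And>n x. norm (g n x) \<le> K * (1 / 2) ^ n * majorant2 a x"
    and fd: "\<And>n x. (f n has_vector_derivative u n x) (at x)"
    and ud: "\<And>n x. (u n has_vector_derivative g n x - 2 * \<i> * of_real \<kappa> * u n x) (at x)"
    by (auto simp: P_def)
  have gS: "g (Suc n) x = of_real (V x) * f n x" for n x
    using tS[of n] by (simp add: g_def f_def)
  have geo: "summable (\<lambda>n. K * (1 / 2) ^ n * w)" "(\<Sum>n. K * (1 / 2) ^ n * w) = 2 * K * w" for w :: real
  proof -
    have "(\<lambda>n. K * (1 / 2) ^ n * w) sums (K * (1 / (1 - 1 / 2)) * w)"
      by (intro sums_mult sums_mult2 geometric_sums) simp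
    then show "summable (\<lambda>n. K * (1 / 2) ^ n * w)" "(\<Sum>n. K * (1 / 2) ^ n * w) = 2 * K * w"
      by (auto simp: sums_iff)
  qed
  have sf: "summable (\<lambda>n. f n x)" and su: "summable (\<lambda>n. u n x)" and sg: "summable (\<lambda>n. g n x)" for x
    by (rule summable_comparison_test'[OF geo(1)[of "majorant a x"]], rule fb)
      (rule summable_comparison_test'[OF geo(1)[of "majorant1 a x"]], rule ub,
       rule summable_comparison_test'[OF geo(1)[of "majorant2 a x"]], rule gb)
  define F U where "F x = (\<Sum>n. f n x)" and "U x = (\<Sum>n. u n x)" for x
  have c1: "isCont (majorant1 a) x" for x using majorant1_has_derivative by (rule DERIV_isCont)
  have c2: "isCont (majorant2 a) x" for x
    unfolding majorant2_def[abs_def] decay_base_def[abs_def]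
    by (intro continuous_intros) (auto simp: add_nonneg_eq_0_iff)
  have dF: "(F has_vector_derivative U x) (at x)" for x
    unfolding F_def[abs_def] U_def
    by (rule has_vector_derivative_series[where B = "\<lambda>x. K * majorant1 a x"])
      (use fd sf ub c1 in \<open>auto intro!: continuous_intros simp: ac_simps\<close>)
  have "(U has_vector_derivative (\<Sum>n. g n x - 2 * \<i> * of_real \<kappa> * u n x)) (at x)" for x
    unfolding U_def[abs_def]
  proof (rule has_vector_derivative_series[where B = "\<lambda>x. K * (majorant2 a x + 2 * \<bar>\<kappa>\<bar> * majorant1 a x)"])
    show "norm (g n x - 2 * \<i> * of_real \<kappa> * u n x)
        \<le> K * (majorant2 a x + 2 * \<bar>\<kappa>\<bar> * majorant1 a x) * (1 / 2) ^ n" for n x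
    proof -
      have "norm (g n x - 2 * \<i> * of_real \<kappa> * u n x) \<le> norm (g n x) + 2 * \<bar>\<kappa>\<bar> * norm (u n x)"
        by (rule order_trans[OF norm_triangle_ineq4]) (simp add: norm_mult)
      also have "\<dots> \<le> K * (1 / 2) ^ n * majorant2 a x + 2 * \<bar>\<kappa>\<bar> * (K * (1 / 2) ^ n * majorant1 a x)"
        using gb ub by (intro add_mono mult_left_mono) auto
      finally show ?thesis by (simp add: algebra_simps)
    qed
  qed (use ud su c1 c2 in \<open>auto intro!: continuous_intros\<close>)
  moreover have "(\<Sum>n. g n x - 2 * \<i> * of_real \<kappa> * u n x)
      = of_real (V x) * F x + S x - 2 * \<i> * of_real \<kappa> * U x" for x
  proof -
    \<comment> \<open>The head \<open>g 0\<close> is \<open>S\<close> and the remaining sources add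
      up to V F, so the sum solves the full equation.\<close>
    have "(\<Sum>n. g n x) = (\<Sum>n. g (Suc n) x) + g 0 x"
      using suminf_split_head[OF sg[of x]] by simp
    also have "(\<Sum>n. g (Suc n) x) = of_real (V x) * F x"
      unfolding gS F_def by (rule suminf_mult[OF sf])
    finally show ?thesis
      unfolding suminf_diff[OF sg summable_mult[OF su], symmetric] suminf_mult[OF su] U_def g0 by simp
  qed
  ultimately have dU: "(U has_vector_derivative of_real (V x) * F x + S x - 2 * \<i> * of_real \<kappa> * U x) (at x)" for x
    by simp
  have Fb: "norm (F x) \<le> 2 * K * majorant a x" for x
    unfolding F_def geo(2)[symmetric] by (rule norm_suminf_le[OF fb geo(1)])
  have Ub: "norm (U x) \<le> 2 * K * majorant1 a x" for x
    unfolding U_def geo(2)[symmetric] by (rule norm_suminf_le[OF ub geo(1)])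
  have "(F \<longlongrightarrow> 0) at_top"
    by (rule Lim_null_comparison[where g = "\<lambda>x. 2 * K * majorant a x"])
      (use Fb a tendsto_mult_left[OF tendsto_majorant(1), of a "2 * K"] in auto)
  moreover have "(U \<longlongrightarrow> 0) at_top"
    by (rule Lim_null_comparison[where g = "\<lambda>x. 2 * K * majorant1 a x"])
      (use Ub a tendsto_mult_left[OF tendsto_majorant(2), of a "2 * K"] in auto)
  ultimately show thesis
    using dF dU that by (auto simp: decaying_solution_def)
qed

end

section \<open>Smooth families with weighted bounds\<close>

text \<open>One order \<open>c\<close> serves all derivatives: differentiation in x neither costs
  nor gains weight, as in the claimed bounds for l \<ge> 1.\<close>

primrec tame_n :: "nat \<Rightarrow> 'i set \<Rightarrow> nat \<Rightarrow> ('i \<Rightarrow> real \<Rightarrow> complex) \<Rightarrow> bool" where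
  "tame_n 0 I c g \<longleftrightarrow> tame I c g"
| "tame_n (Suc n) I c g \<longleftrightarrow> tame I c g \<and>
     (\<exists>g'. (\<forall>i\<in>I. \<forall>x. (g i has_vector_derivative g' i x) (at x)) \<and> tame_n n I c g')"

lemma tame_nD: "tame_n n I c g \<Longrightarrow> tame I c g"
  by (cases n) auto

lemma tame_n_SucI:
  assumes "tame I c g" "\<And>i x. i \<in> I \<Longrightarrow> (g i has_vector_derivative g' i x) (at x)" "tame_n n I c g'"
  shows "tame_n (Suc n) I c g"
  using assms by auto

lemma tame_n_SucD: "tame_n (Suc n) I c g \<Longrightarrow> tame_n n I c g"
  by (induction n arbitrary: g) (simp, metis tame_n.simps(2))

lemma tame_n_mono: "tame_n n I c g \<Longrightarrow> c \<le> d \<Longrightarrow> tame_n n I d g"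
  by (induction n arbitrary: g) (auto intro: tame_mono)

lemma tame_n_cong:
  assumes "\<And>i x. i \<in> I \<Longrightarrow> g i x = h i x"
  shows "tame_n n I c g = tame_n n I c h"
proof -
  have "g i = h i" if "i \<in> I" for i using assms[OF that] by auto
  then show ?thesis
    by (cases n) (auto simp: tame_def)
qed

lemma tame_n_derivative:
  assumes "tame_n (Suc n) I c g" "\<And>i x. i \<in> I \<Longrightarrow> (g i has_vector_derivative g' i x) (at x)"
  shows "tame_n n I c g'"
proof -
  obtain h where h: "\<forall>i\<in>I. \<forall>x. (g i has_vector_derivative h i x) (at x)" "tame_n n I c h"
    using assms(1) by auto
  have "g' i x = h i x" if "i \<in> I" for i x
    using h(1) assms(2)[OF that] that vector_derivative_unique_at by blast
  then show ?thesis using h(2) tame_n_cong[of I g' h n c] by blast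
qed

lemma tame_n_add:
  assumes "tame_n n I c g" "tame_n n I c h"
  shows "tame_n n I c (\<lambda>i x. g i x + h i x)"
  using assms
proof (induction n arbitrary: g h)
  case (Suc n)
  obtain g' h' where g': "\<forall>i\<in>I. \<forall>x. (g i has_vector_derivative g' i x) (at x)" "tame_n n I c g'"
    and h': "\<forall>i\<in>I. \<forall>x. (h i has_vector_derivative h' i x) (at x)" "tame_n n I c h'"
    using Suc.prems by auto
  show ?case
  proof (rule tame_n_SucI)
    show "tame_n n I c (\<lambda>i x. g' i x + h' i x)" using g' h' by (intro Suc.IH)
  qed (use Suc.prems g' h' in \<open>auto intro: tame_add has_vector_derivative_add\<close>)
qed (simp add: tame_add)

lemma tame_n_cmult:
  assumes "tame_n n I c g"
  shows "tame_n n I c (\<lambda>i x. a * g i x)"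
  using assms
proof (induction n arbitrary: g)
  case (Suc n)
  obtain g' where g': "\<forall>i\<in>I. \<forall>x. (g i has_vector_derivative g' i x) (at x)" "tame_n n I c g'"
    using Suc.prems by auto
  show ?case
  proof (rule tame_n_SucI)
    show "tame_n n I c (\<lambda>i x. a * g' i x)" using g' by (intro Suc.IH)
  qed (use Suc.prems g' in \<open>auto intro: tame_cmult has_vector_derivative_mult_right\<close>)
qed (simp add: tame_cmult)

lemma tame_reindex:
  assumes "tame J c g" "\<And>i. i \<in> I \<Longrightarrow> h i \<in> J"
  shows "tame I c (\<lambda>i. g (h i))"
  using assms unfolding tame_def by meson

lemma tame_n_reindex:
  assumes "tame_n n J c g" "\<And>i. i \<in> I \<Longrightarrow> h i \<in> J"
  shows "tame_n n I c (\<lambda>i. g (h i))"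
  using assms(1)
proof (induction n arbitrary: g)
  case (Suc n)
  then obtain g' where g': "\<forall>i\<in>J. \<forall>x. (g i has_vector_derivative g' i x) (at x)" "tame_n n J c g'"
    by auto
  show ?case
    by (rule tame_n_SucI[where g' = "\<lambda>i. g' (h i)"])
      (use Suc g' assms(2) in \<open>auto intro: tame_reindex\<close>)
next
  case 0
  then show ?case using tame_reindex[of J c g I h] assms(2) by simp
qed

lemma tame_tendsto_0:
  assumes "tame I c g" "i \<in> I"
  shows "(g i \<longlongrightarrow> 0) at_top"
proof -
  obtain C where C: "0 \<le> C"
    "\<And>i x. i \<in> I \<Longrightarrow> norm (g i x) * wt x ^ 1 * (wt (- x))\<^sup>2 \<le> C * wt (- x) ^ c"
    using assms(1) by (rule tameE[where N = 1]) blast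
  have "((\<lambda>x. C / x) \<longlongrightarrow> 0) at_top"
    by (intro tendsto_divide_0[OF tendsto_const] filterlim_at_top_imp_at_infinity filterlim_ident)
  then show ?thesis
  proof (rule Lim_null_comparison[rotated])
    show "\<forall>\<^sub>F x in at_top. norm (g i x) \<le> C / x"
      using eventually_gt_at_top[of 0]
    proof eventually_elim
      case (elim x)
      then have "norm (g i x) * (1 + x) \<le> C" using C(2)[OF assms(2), of x] by (simp add: wt_def)
      then have "norm (g i x) * x \<le> C" by (simp add: algebra_simps) (smt (verit) norm_ge_zero)
      with elim show ?case by (simp add: field_simps)
    qed
  qed
qed

text \<open>Order c means growth of degree c - 2 at the left end. For c = 0 the integrand is
  integrable there and the integral stays bounded, which is order 2; for c \<ge> 2 integration
  raises the degree by one.\<close>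

definition gain :: "nat \<Rightarrow> nat" where
  "gain c = (if c = 0 then 2 else c + 1)"

text \<open>The case \<open>c = 1\<close> is excluded: there the integral grows logarithmically at \<open>-\<infinity>\<close>.\<close>

lemma tame_primitive:
  assumes U: "\<And>i x. i \<in> I \<Longrightarrow> (U i has_vector_derivative H i x - 2 * \<i> * of_real (\<kappa> i) * U i x) (at x)"
    and U0: "\<And>i. i \<in> I \<Longrightarrow> (U i \<longlongrightarrow> 0) at_top"
    and H: "tame I c H" and c: "c = 0 \<or> 2 \<le> c"
  shows "tame I (gain c) U"
proof (rule tameI)
  fix N
  obtain C where C: "0 \<le> C"
    "\<And>i x. i \<in> I \<Longrightarrow> norm (H i x) * wt x ^ (N + 2) * (wt (- x))\<^sup>2 \<le> C * wt (- x) ^ c"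
    using H by (rule tameE[where N = "N + 2"]) blast
  have pos: "norm (U i x) * (1 + x) ^ (N + 1) \<le> C" if i: "i \<in> I" and x: "0 \<le> x" for i x
  proof -
    \<comment> \<open>The tail integral of \<open>C / (1 + y) ^ (N + 2)\<close>: integration costs
      one power of decay.\<close>
    define \<Phi> where "\<Phi> y = C / real (N + 1) * inverse (1 + y) ^ (N + 1)" for y :: real
    have "norm (U i x) \<le> \<Phi> x"
    proof (rule osc_tail_bound[where a = x and U = "U i" and \<Phi> = \<Phi> and \<kappa> = "\<kappa> i" and H = "H i"
          and \<Phi>' = "\<lambda>y. - (C / (1 + y) ^ (N + 2))"])
      show "(\<Phi> has_real_derivative - (C / (1 + y) ^ (N + 2))) (at y)" if "x \<le> y" for y
      proof -
        have y: "1 + y \<noteq> 0" using that x by simp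
        have "((\<lambda>y. inverse (1 + y)) has_real_derivative - (inverse (1 + y) ^ 2)) (at y)"
          using y by (auto intro!: derivative_eq_intros simp: power2_eq_square field_simps)
        then have d: "((\<lambda>y. C / real (N + 1) * inverse (1 + y) ^ (N + 1)) has_real_derivative
            C / real (N + 1) * (of_nat (N + 1) * (- (inverse (1 + y) ^ 2) * inverse (1 + y) ^ (N + 1 - Suc 0)))) (at y)"
          by (intro DERIV_cmult DERIV_power)
        have r: "C / r * (r * (- (inverse (1 + y) ^ 2) * inverse (1 + y) ^ (N + 1 - Suc 0)))
            = - (C / (1 + y) ^ (N + 2))" if "r \<noteq> 0" for r
          using that y by (simp add: field_simps power_add power2_eq_square)
        from r[of "real (N + 1)"]
        have "C / real (N + 1) * (of_nat (N + 1) * (- (inverse (1 + y) ^ 2) * inverse (1 + y) ^ (N + 1 - Suc 0)))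
            = - (C / (1 + y) ^ (N + 2))" by simp
        with d show ?thesis unfolding \<Phi>_def[abs_def] by (simp only:)
      qed
      show "norm (H i y) \<le> - (- (C / (1 + y) ^ (N + 2)))" if "x \<le> y" for y
      proof -
        have "0 < (1 + y) ^ (N + 2)" using that x by simp
        then show ?thesis
          using C(2)[OF i, of y] that x unfolding minus_minus
          by (subst pos_le_divide_eq) (auto simp: wt_def)
      qed
      have "((\<lambda>y::real. inverse (1 + y)) \<longlongrightarrow> 0) at_top"
        by (intro tendsto_inverse_0_at_top filterlim_tendsto_add_at_top[OF tendsto_const] filterlim_ident)
      from tendsto_mult_left[OF tendsto_power[OF this, of "N + 1"], of "C / real (N + 1)"]
      show "(\<Phi> \<longlongrightarrow> 0) at_top" by (simp add: \<Phi>_def[abs_def])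
    qed (use U[OF i] U0[OF i] in auto)
    then have "norm (U i x) * (1 + x) ^ (N + 1) \<le> \<Phi> x * (1 + x) ^ (N + 1)"
      using x by (intro mult_right_mono) auto
    also have "\<dots> = C / real (N + 1) * (inverse (1 + x) * (1 + x)) ^ (N + 1)"
      unfolding power_mult_distrib \<Phi>_def by (simp only: mult.assoc)
    also have "\<dots> = C / real (N + 1)" using x by simp
    also have "\<dots> \<le> C" using C(1) by (simp add: field_simps)
    finally show ?thesis .
  qed
  \<comment> \<open>On the left half line the integration starts at 0, where \<open>pos\<close>
    bounds \<open>U\<close> by \<open>C\<close>.\<close>
  have neg: "norm (U i x) * (1 - x)\<^sup>2 \<le> 2 * C * (1 - x) ^ gain c" if i: "i \<in> I" and x: "x \<le> 0" for i x
  proof -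
    define f where "f y = osc (\<kappa> i) y * U i y" for y
    have f: "(f has_vector_derivative osc (\<kappa> i) y * H i y) (at y)" for y
      unfolding f_def[abs_def] using U[OF i] by (rule osc_has_vector_derivative)
    have H': "norm (osc (\<kappa> i) y * H i y) * (1 - y)\<^sup>2 \<le> C * (1 - y) ^ c" if "y \<le> 0" for y
      using C(2)[OF i, of y] that by (simp add: wt_def norm_mult)
    have f0: "norm (f 0) \<le> C" using pos[OF i, of 0] by (simp add: f_def norm_mult)
    have "norm (f x) \<le> norm (f 0 - f x) + norm (f 0)"
      by (metis norm_minus_commute norm_triangle_sub add.commute)
    moreover have "norm (f x) = norm (U i x)" by (simp add: f_def norm_mult)
    ultimately have Ux: "norm (U i x) \<le> norm (f 0 - f x) + C" using f0 by linarith
    show ?thesis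
    proof (cases "c = 0")
      case True
      have "norm (f 0 - f x) \<le> - (C / (1 - x)) - (- (C / (1 - 0)))"
      proof (rule increment_bound[OF x f, where \<Phi>' = "\<lambda>y. - (C / (1 - y)\<^sup>2)"])
        show "((\<lambda>y. - (C / (1 - y))) has_real_derivative - (C / (1 - y)\<^sup>2)) (at y)" if "y \<le> 0" for y
          using that by (auto intro!: derivative_eq_intros simp: power2_eq_square)
        show "norm (osc (\<kappa> i) y * H i y) \<le> - (- (C / (1 - y)\<^sup>2))" if "y \<le> 0" for y
          using H'[OF that] that True by (simp add: field_simps)
      qed
      also have "\<dots> \<le> C" using C(1) x by simp
      finally have "norm (U i x) \<le> 2 * C" using Ux by simp
      then show ?thesis using True by (simp add: gain_def mult_right_mono)
    next
      case False
      then obtain d where d: "c = d + 2" using c by (metis add.commute le_Suc_ex)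
      \<comment> \<open>On [x, 0] the bound on the integrand is largest at \<open>x\<close>, so a
        linear comparison function, maximum times length, suffices.\<close>
      have "norm (f 0 - f x) \<le> - (C * (1 - x) ^ d * x) - (- (C * (1 - x) ^ d * 0))"
      proof (rule increment_bound[OF x f, where \<Phi>' = "\<lambda>y. - (C * (1 - x) ^ d)"])
        show "((\<lambda>y. - (C * (1 - x) ^ d * y)) has_real_derivative - (C * (1 - x) ^ d)) (at y)" for y
          by (auto intro!: derivative_eq_intros)
        show "norm (osc (\<kappa> i) y * H i y) \<le> - (- (C * (1 - x) ^ d))" if y: "x \<le> y" "y \<le> 0" for y
        proof -
          have "norm (osc (\<kappa> i) y * H i y) * (1 - y)\<^sup>2 \<le> (C * (1 - y) ^ d) * (1 - y)\<^sup>2"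
            using H'[OF y(2)] by (simp add: d power_add power2_eq_square ac_simps)
          then have "norm (osc (\<kappa> i) y * H i y) \<le> C * (1 - y) ^ d"
            using y by (subst (asm) mult_le_cancel_right) auto
          also have "\<dots> \<le> C * (1 - x) ^ d"
            using y C(1) by (intro mult_left_mono power_mono) auto
          finally show ?thesis by simp
        qed
      qed
      also have "\<dots> = C * (1 - x) ^ d * (- x)" by simp
      also have "\<dots> \<le> C * (1 - x) ^ d * (1 - x)"
        using C(1) x by (intro mult_left_mono) auto
      finally have "norm (f 0 - f x) \<le> C * (1 - x) ^ (d + 1)" by (simp add: ac_simps)
      moreover have "C * 1 \<le> C * (1 - x) ^ (d + 1)"
        using C(1) x by (intro mult_left_mono one_le_power) auto
      ultimately have "norm (U i x) \<le> 2 * C * (1 - x) ^ (d + 1)" using Ux by simp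
      then have "norm (U i x) * (1 - x)\<^sup>2 \<le> 2 * C * (1 - x) ^ (d + 1) * (1 - x)\<^sup>2"
        by (rule mult_right_mono) simp
      then show ?thesis by (simp add: gain_def d power_add power2_eq_square ac_simps)
    qed
  qed
  have "norm (U i x) * wt x ^ N * (wt (- x))\<^sup>2 \<le> 2 * C * wt (- x) ^ gain c" if i: "i \<in> I" for i x
  proof (cases "0 \<le> x")
    case True
    have "norm (U i x) * (1 + x) ^ N \<le> norm (U i x) * (1 + x) ^ (N + 1)"
      using True by (intro mult_left_mono power_increasing) auto
    also have "\<dots> \<le> 2 * C" using pos[OF i True] C(1) by linarith
    finally show ?thesis using True by (simp add: wt_def)
  next
    case False
    then show ?thesis using neg[OF i, of x] by (simp add: wt_def)
  qed
  then show "\<exists>C. \<forall>i\<in>I. \<forall>x. norm (U i x) * wt x ^ N * (wt (- x))\<^sup>2 \<le> C * wt (- x) ^ gain c"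
    by blast
qed

text \<open>Reading U' off as \<open>H - 2 i \<kappa> U\<close> would lose uniformity in \<kappa>.
  Instead U' solves the same first-order equation with source H' and also vanishes at infinity, so
  the induction hypothesis applies to it.\<close>

lemma tame_n_primitive:
  assumes "\<And>i x. i \<in> I \<Longrightarrow> (U i has_vector_derivative H i x - 2 * \<i> * of_real (\<kappa> i) * U i x) (at x)"
    and "\<And>i. i \<in> I \<Longrightarrow> (U i \<longlongrightarrow> 0) at_top"
    and "tame_n n I c H" and "c = 0 \<or> 2 \<le> c"
  shows "tame_n n I (gain c) U"
  using assms(1-3)
proof (induction n arbitrary: U H)
  case 0
  show ?case
    using tame_primitive[where \<kappa> = \<kappa>, OF 0(1,2) _ assms(4)] 0(3) by simp
next
  case (Suc n)
  note U = Suc.prems(1) and U0 = Suc.prems(2)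
  obtain H' where H': "\<And>i x. i \<in> I \<Longrightarrow> (H i has_vector_derivative H' i x) (at x)" "tame_n n I c H'"
    using Suc.prems(3) by auto
  define U' where "U' i x = H i x - 2 * \<i> * of_real (\<kappa> i) * U i x" for i x
  show ?case
  proof (rule tame_n_SucI[where g' = U'])
    show "tame I (gain c) U"
      using tame_primitive[OF U U0 tame_nD[OF Suc.prems(3)] assms(4)] .
    show "(U i has_vector_derivative U' i x) (at x)" if "i \<in> I" for i x
      using U[OF that] by (simp add: U'_def)
    show "tame_n n I (gain c) U'"
    proof (rule Suc.IH[OF _ _ H'(2)])
      show "(U' i has_vector_derivative H' i x - 2 * \<i> * of_real (\<kappa> i) * U' i x) (at x)"
        if "i \<in> I" for i x
      proof -
        have "((\<lambda>x. H i x - 2 * \<i> * of_real (\<kappa> i) * U i x) has_vector_derivative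
            H' i x - 2 * \<i> * of_real (\<kappa> i) * (H i x - 2 * \<i> * of_real (\<kappa> i) * U i x)) (at x)"
          by (intro has_vector_derivative_diff has_vector_derivative_mult_right H' U that)
        then show ?thesis by (simp add: U'_def[abs_def])
      qed
      show "(U' i \<longlongrightarrow> 0) at_top" if "i \<in> I" for i
      proof -
        have "((\<lambda>x. H i x - 2 * \<i> * of_real (\<kappa> i) * U i x) \<longlongrightarrow> 0 - 2 * \<i> * of_real (\<kappa> i) * 0) at_top"
          by (intro tendsto_intros tame_tendsto_0[OF tame_nD[OF Suc.prems(3)] that] U0[OF that])
        then show ?thesis by (simp add: U'_def[abs_def])
      qed
    qed
  qed
qed

section \<open>Sharp weighted bounds for decaying solutions\<close>

context schwartz_potential
begin

lemma tame_n_V_mult: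
  assumes "tame_n n I c g"
  shows "tame_n n I 0 (\<lambda>i x. of_real ((deriv ^^ j) V x) * g i x)"
  using assms
proof (induction n arbitrary: j g)
  case (Suc n)
  obtain g' where g': "\<forall>i\<in>I. \<forall>x. (g i has_vector_derivative g' i x) (at x)" "tame_n n I c g'"
    using Suc.prems by auto
  have dV: "((\<lambda>x. complex_of_real ((deriv ^^ j) V x)) has_vector_derivative
      of_real ((deriv ^^ Suc j) V x)) (at x)" for x
    using V_has_derivative[of j x]
    by (intro has_vector_derivative_of_real) (simp add: has_real_derivative_iff_has_vector_derivative)
  show ?case
  proof (rule tame_n_SucI)
    show "tame I 0 (\<lambda>i x. of_real ((deriv ^^ j) V x) * g i x)"
      using Suc.prems by (intro tame_V_mult[where c = c]) auto
    show "((\<lambda>x. of_real ((deriv ^^ j) V x) * g i x) has_vector_derivative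
        of_real ((deriv ^^ j) V x) * g' i x + of_real ((deriv ^^ Suc j) V x) * g i x) (at x)"
      if "i \<in> I" for i x
      using g'(1) that by (intro has_vector_derivative_mult dV) auto
    show "tame_n n I 0 (\<lambda>i x. of_real ((deriv ^^ j) V x) * g' i x
        + of_real ((deriv ^^ Suc j) V x) * g i x)"
      using g'(2) tame_n_SucD[OF Suc.prems] by (intro tame_n_add Suc.IH)
  qed
qed (simp add: tame_V_mult)

lemma tame_n_V: "tame_n n I 0 (\<lambda>i x. of_real ((deriv ^^ j) V x))"
proof (induction n arbitrary: j)
  case (Suc n)
  show ?case
  proof (rule tame_n_SucI[OF tame_V _ Suc.IH])
    show "((\<lambda>x. complex_of_real ((deriv ^^ j) V x)) has_vector_derivative
        of_real ((deriv ^^ Suc j) V x)) (at x)" for x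
      using V_has_derivative[of j x]
      by (intro has_vector_derivative_of_real) (simp add: has_real_derivative_iff_has_vector_derivative)
  qed
qed (use tame_V in simp)

text \<open>The a priori bound gives \<open>F\<close> polynomial growth of a degree depending on
  \<open>V\<close> and \<open>c\<close>. Multiplication by \<open>V\<close> reduces it to order 0,
  so one integration yields the order of \<open>U\<close> and another that of \<open>F\<close>. The
  last claim saves the second integration at the price of a factor \<kappa>.\<close>

lemma decaying_solution_tame:
  assumes sol: "\<And>i. i \<in> I \<Longrightarrow> decaying_solution (\<kappa> i) (S i) (F i) (U i)"
    and S: "\<And>n. tame_n n I c S" and c: "c = 0 \<or> 2 \<le> c"
  shows "\<And>n. tame_n n I (gain c) U" "\<And>n. tame_n n I (Suc (gain c)) F"
    "tame I (gain c) (\<lambda>i x. of_real (\<kappa> i) * F i x)"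
proof -
  have dF: "(F i has_vector_derivative U i x) (at x)"
    and dU: "(U i has_vector_derivative of_real (V x) * F i x + S i x - 2 * \<i> * of_real (\<kappa> i) * U i x) (at x)"
    and F0: "(F i \<longlongrightarrow> 0) at_top" and U0: "(U i \<longlongrightarrow> 0) at_top" if "i \<in> I" for i x
    using sol[OF that] by (auto simp: decaying_solution_def)
  have S0: "tame I c S" using S[of 0] by simp
  obtain a0 where a0: "2 \<le> a0" "\<And>a x. a0 \<le> a \<Longrightarrow> \<bar>V x\<bar> * majorant a x \<le> majorant2 a x / 2"
    by (rule V_majorant) blast
  define a where "a = max a0 c"
  have a: "a0 \<le> a" "c \<le> a" "2 \<le> a" using a0 by (auto simp: a_def)
  obtain K where K: "0 \<le> K" "\<And>i x. i \<in> I \<Longrightarrow> norm (S i x) \<le> K * majorant2 a x"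
    using tame_le_majorant2[OF S0 a(2,3)] by blast
  have rough: "norm (F i x) \<le> 2 * K * 2 ^ a * wt (- x) ^ a" if i: "i \<in> I" for i x
  proof -
    have "norm (F i x) \<le> 2 * K * majorant a x"
      using decaying_solution_bound[OF sol[OF i] a(3) a0(2)[OF a(1)] K(1) K(2)[OF i]] .
    also have "\<dots> \<le> 2 * K * (2 * wt (- x)) ^ a"
      using K(1) decay_base_le[of x] decay_base_pos[of x] unfolding majorant_def
      by (intro mult_left_mono power_mono) auto
    finally show ?thesis by (simp add: power_mult_distrib)
  qed
  have VF: "tame I 0 (\<lambda>i x. of_real (V x) * F i x)"
    using tame_V_mult_growth[of I F, OF rough, where j = 0] by simp
  have U_tame: "tame I (gain c) U"
    by (rule tame_primitive[OF dU U0 tame_add[OF tame_mono[OF VF] S0] c]) auto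
  have gain: "2 \<le> gain c" "gain c \<noteq> 0" "gain (gain c) = Suc (gain c)" "c \<le> gain c"
    using c by (auto simp: gain_def)
  have "tame I (gain (gain c)) F"
    by (rule tame_primitive[where \<kappa> = "\<lambda>_. 0" and H = U]) (use dF F0 U_tame gain in auto)
  then have F_tame: "tame I (Suc (gain c)) F" by (simp add: gain)
  \<comment> \<open>Bootstrap: control of n derivatives of \<open>U\<close> gives n + 1 of
    \<open>F\<close>, hence n + 1 of V F + S, hence n + 1 of \<open>U\<close>.\<close>
  show U_n: "tame_n n I (gain c) U" for n
  proof (induction n)
    case (Suc n)
    have "tame_n (Suc n) I (Suc (gain c)) F"
      by (rule tame_n_SucI[OF F_tame dF tame_n_mono[OF Suc.IH]]) auto
    then have "tame_n (Suc n) I 0 (\<lambda>i x. of_real (V x) * F i x)"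
      by (rule tame_n_V_mult[where j = 0, simplified])
    then have "tame_n (Suc n) I c (\<lambda>i x. of_real (V x) * F i x + S i x)"
      using S by (intro tame_n_add) (auto intro: tame_n_mono simp del: tame_n.simps)
    from tame_n_primitive[OF dU U0 this c] show ?case by blast
  qed (simp add: U_tame)
  show "tame_n n I (Suc (gain c)) F" for n
    by (cases n, simp add: F_tame)
      (use tame_n_SucI[OF F_tame dF tame_n_mono[OF U_n]] in simp)
  have Y: "tame I (gain c) (\<lambda>i x. U i x + 2 * \<i> * of_real (\<kappa> i) * F i x)"
  proof (rule tame_primitive[where \<kappa> = "\<lambda>_. 0", OF _ _ tame_add[OF tame_mono[OF VF] S0] c])
    fix i x assume i: "i \<in> I"
    have "((\<lambda>x. U i x + 2 * \<i> * of_real (\<kappa> i) * F i x) has_vector_derivative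
        of_real (V x) * F i x + S i x - 2 * \<i> * of_real (\<kappa> i) * U i x + 2 * \<i> * of_real (\<kappa> i) * U i x) (at x)"
      by (intro has_vector_derivative_add has_vector_derivative_mult_right dF[OF i] dU[OF i])
    then show "((\<lambda>x. U i x + 2 * \<i> * of_real (\<kappa> i) * F i x) has_vector_derivative
        of_real (V x) * F i x + S i x - 2 * \<i> * of_real 0 * (U i x + 2 * \<i> * of_real (\<kappa> i) * F i x)) (at x)"
      by simp
  next
    fix i assume i: "i \<in> I"
    have "((\<lambda>x. U i x + 2 * \<i> * of_real (\<kappa> i) * F i x) \<longlongrightarrow> 0 + 2 * \<i> * of_real (\<kappa> i) * 0) at_top"
      by (intro tendsto_intros U0[OF i] F0[OF i])
    then show "((\<lambda>x. U i x + 2 * \<i> * of_real (\<kappa> i) * F i x) \<longlongrightarrow> 0) at_top" by simp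
  qed simp
  from tame_cmult[OF tame_add[OF Y tame_cmult[OF U_tame, of "- 1"]], of "1 / (2 * \<i>)"]
  show "tame I (gain c) (\<lambda>i x. of_real (\<kappa> i) * F i x)" by simp
qed

end

section \<open>Derivatives in the spectral parameter\<close>

abbreviation vderiv :: "(real \<Rightarrow> complex) \<Rightarrow> real \<Rightarrow> complex" where
  "vderiv f \<equiv> \<lambda>x. vector_derivative f (at x)"

text \<open>Replaces the derivative families hidden in the existential of \<open>tame_n\<close> by
  iterates of \<open>vderiv\<close>. All orders are assumed at once because each differentiation
  uses one up.\<close>

lemma tame_n_vderiv_iterate:
  assumes "\<And>n. tame_n n I c g"
  shows "tame_n n I c (\<lambda>i. (vderiv ^^ l) (g i))"
    and "i \<in> I \<Longrightarrow> ((vderiv ^^ l) (g i) has_vector_derivative (vderiv ^^ Suc l) (g i) x) (at x)"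
proof -
  have *: "(h i has_vector_derivative vderiv (h i) x) (at x)"
    if "\<And>n. tame_n n I c h" "i \<in> I" for h i x
    using that(1)[of 1] that(2) by (auto simp: vector_derivative_works[symmetric] intro: differentiableI_vector)
  have t: "tame_n n I c (\<lambda>i. (vderiv ^^ l) (g i))" for n l
  proof (induction l arbitrary: n)
    case (Suc l)
    have "tame_n n I c (\<lambda>i x. vderiv ((vderiv ^^ l) (g i)) x)"
      by (rule tame_n_derivative[OF Suc.IH]) (rule *[OF Suc.IH])
    then show ?case by simp
  qed (simp add: assms)
  from t show "tame_n n I c (\<lambda>i. (vderiv ^^ l) (g i))" .
  show "((vderiv ^^ l) (g i) has_vector_derivative (vderiv ^^ Suc l) (g i) x) (at x)" if "i \<in> I"
    using *[OF t that] by simp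
qed

section \<open>Linear structure and the candidates for the k-derivatives\<close>

context schwartz_potential
begin

lemma decaying_solution_add:
  assumes "decaying_solution \<kappa> S F U" "decaying_solution \<kappa> S' F' U'"
  shows "decaying_solution \<kappa> (\<lambda>x. S x + S' x) (\<lambda>x. F x + F' x) (\<lambda>x. U x + U' x)"
proof -
  have "((\<lambda>x. U x + U' x) has_vector_derivative
      (of_real (V x) * F x + S x - 2 * \<i> * of_real \<kappa> * U x)
      + (of_real (V x) * F' x + S' x - 2 * \<i> * of_real \<kappa> * U' x)) (at x)" for x
    using assms by (intro has_vector_derivative_add) (auto simp: decaying_solution_def)
  then show ?thesis
    using assms tendsto_add[of F 0 at_top F' 0] tendsto_add[of U 0 at_top U' 0]
    by (auto simp: decaying_solution_def algebra_simps intro: has_vector_derivative_add)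
qed

lemma decaying_solution_cmult:
  assumes "decaying_solution \<kappa> S F U"
  shows "decaying_solution \<kappa> (\<lambda>x. a * S x) (\<lambda>x. a * F x) (\<lambda>x. a * U x)"
proof -
  have "((\<lambda>x. a * U x) has_vector_derivative
      a * (of_real (V x) * F x + S x - 2 * \<i> * of_real \<kappa> * U x)) (at x)" for x
    using assms by (intro has_vector_derivative_mult_right) (auto simp: decaying_solution_def)
  then show ?thesis
    using assms tendsto_mult_right_zero[of F at_top a] tendsto_mult_right_zero[of U at_top a]
    by (auto simp: decaying_solution_def algebra_simps intro: has_vector_derivative_mult_right)
qed

text \<open>A change of the spectral parameter is moved into the source, so solutions at k +
  \<delta> and k can be subtracted within one equation.\<close>

lemma decaying_solution_shift:
  assumes "decaying_solution (\<kappa> + \<delta>) S F U"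
  shows "decaying_solution \<kappa> (\<lambda>x. S x - 2 * \<i> * of_real \<delta> * U x) F U"
  using assms by (simp add: decaying_solution_def algebra_simps)

text \<open>Differentiating \<open>m'' + 2 i k m' = V m\<close> in \<open>k\<close> gives the same equation for the \<open>n\<close>-th
  \<open>k\<close>-derivative, with source \<open>- 2 i n \<partial>\<^sub>x \<partial>\<^sub>k\<^sup>n\<^sup>-\<^sup>1 m\<close>; for \<open>n = 0\<close> the unknown is \<open>m - 1\<close>. The pairs
  below are these functions of \<open>x\<close> with their \<open>x\<close>-derivatives.\<close>

primrec jost_jet :: "nat \<Rightarrow> real \<Rightarrow> (real \<Rightarrow> complex) \<times> (real \<Rightarrow> complex)" where
  "jost_jet 0 k = (SOME p. decaying_solution k (\<lambda>x. of_real (V x)) (fst p) (snd p))"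
| "jost_jet (Suc n) k = (SOME p. decaying_solution k
     (\<lambda>x. - 2 * \<i> * of_nat (Suc n) * snd (jost_jet n k) x) (fst p) (snd p))"

definition mder :: "nat \<Rightarrow> real \<Rightarrow> real \<Rightarrow> complex" where
  "mder n k = fst (jost_jet n k)"

definition mder_x :: "nat \<Rightarrow> real \<Rightarrow> real \<Rightarrow> complex" where
  "mder_x n k = snd (jost_jet n k)"

definition source :: "nat \<Rightarrow> real \<Rightarrow> real \<Rightarrow> complex" where
  "source n k = (case n of 0 \<Rightarrow> (\<lambda>x. of_real (V x)) | Suc j \<Rightarrow> (\<lambda>x. - 2 * \<i> * of_nat (Suc j) * mder_x j k x))"

lemma source_simps [simp]:
  "source 0 k x = of_real (V x)"
  "source (Suc n) k x = - 2 * \<i> * of_nat (Suc n) * mder_x n k x"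
  by (simp_all add: source_def)

lemma jost_jet_source:
  "jost_jet n k = (SOME p. decaying_solution k (source n k) (fst p) (snd p))"
  by (cases n) (simp_all add: source_def mder_x_def)

text \<open>The choice by \<open>SOME\<close> is meaningful only if a solution exists, which
  tameness of the source guarantees; that source in turn involves the previous choice. Hence the
  conditional form, discharged by induction in \<open>mder_x_source_tame\<close>.\<close>

lemma mder_solution_if_tame:
  assumes "\<And>m. tame_n m UNIV c (source n)"
  shows "decaying_solution k (source n k) (mder n k) (mder_x n k)"
proof -
  have t: "tame UNIV c (\<lambda>_::unit. source n k)"
    using tame_reindex[of UNIV c "source n" UNIV "\<lambda>_. k"] assms[of 0] by simp
  have "isCont (source n k) x" for x
    using assms[of 1] by (auto intro: has_vector_derivative_continuous)
  then obtain F U where "decaying_solution k (source n k) F U"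
    using decaying_solution_exists[OF t] by blast
  then have "decaying_solution k (source n k) (fst (F, U)) (snd (F, U))" by simp
  then show ?thesis
    unfolding mder_def mder_x_def jost_jet_source by (rule someI)
qed

lemma source_0: "source 0 = (\<lambda>k x. of_real (V x))"
  and source_Suc: "source (Suc n) = (\<lambda>k x. - 2 * \<i> * of_nat (Suc n) * mder_x n k x)"
  by (simp_all add: fun_eq_iff)

text \<open>The source is V for n = 0 and otherwise a multiple of \<open>mder_x (n - 1)\<close>, of
  order n + 1. After \<open>gain\<close> both cases give n + 2, that is growth n, the exponent
  claimed for l \<ge> 1.\<close>

definition source_order :: "nat \<Rightarrow> nat" where
  "source_order n = (if n = 0 then 0 else n + 1)"

lemma source_order: "source_order n = 0 \<or> 2 \<le> source_order n" "gain (source_order n) = n + 2"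
  by (auto simp: source_order_def gain_def)

lemma mder_x_source_tame:
  "tame_n m UNIV (n + 2) (mder_x n)" "tame_n m UNIV (source_order n) (source n)"
proof -
  have step: "tame_n m UNIV (n + 2) (mder_x n)" if "\<And>m. tame_n m UNIV (source_order n) (source n)" for n m
    using decaying_solution_tame(1)[OF mder_solution_if_tame[OF that] that source_order(1)]
    by (simp only: source_order)
  have "\<forall>m. tame_n m UNIV (source_order n) (source n)" for n
  proof (induction n)
    case 0
    show ?case by (simp add: source_0 source_order_def tame_n_V[where j = 0, simplified])
  next
    case (Suc n)
    then have "tame_n m UNIV (n + 2) (mder_x n)" for m using step by blast
    note tame_n_cmult[OF this]
    moreover have "source_order (Suc n) = n + 2" by (simp add: source_order_def)
    ultimately show ?case unfolding source_Suc by metis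
  qed
  then show "tame_n m UNIV (n + 2) (mder_x n)" "tame_n m UNIV (source_order n) (source n)"
    using step by blast+
qed

lemmas mder_x_tame = mder_x_source_tame(1) and source_tame = mder_x_source_tame(2)

lemma mder_solution: "decaying_solution k (source n k) (mder n k) (mder_x n k)"
  using source_tame by (rule mder_solution_if_tame)

lemma mder_tame: "tame_n m UNIV (Suc (n + 2)) (mder n)"
  "tame UNIV (n + 2) (\<lambda>k x. of_real k * mder n k x)"
  using decaying_solution_tame(2)[OF mder_solution source_tame source_order(1)]
    decaying_solution_tame(3)[OF mder_solution source_tame source_order(1)]
  unfolding source_order by blast+

lemma mder_has_derivative: "(mder n k has_vector_derivative mder_x n k x) (at x)"
  using mder_solution by (simp add: decaying_solution_def)

lemma mder_x_has_derivative:
  "(mder_x n k has_vector_derivative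
    of_real (V x) * mder n k x + source n k x - 2 * \<i> * of_real k * mder_x n k x) (at x)"
  using mder_solution by (simp add: decaying_solution_def)

text \<open>The equation expresses \<open>2 i k \<partial>\<^sub>x m\<close> without the factor \<open>k\<close>, so multiplying the source
  of order \<open>n\<close> by \<open>k\<^sup>n\<close> does not spoil uniformity in \<open>k\<close>.\<close>

lemma scaled_source_tame:
  "tame_n m UNIV (source_order n) (\<lambda>k x. of_real k ^ n * source n k x)"
proof (induction n arbitrary: m)
  case (Suc n)
  let ?G = "\<lambda>k x. of_real k ^ n * mder n k x" and ?W = "\<lambda>k x. of_real k ^ n * mder_x n k x"
    and ?S = "\<lambda>k x. of_real k ^ n * source n k x"
  have sol: "decaying_solution k (?S k) (?G k) (?W k)" for k
    by (rule decaying_solution_cmult[OF mder_solution])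
  have W: "tame_n m UNIV (n + 2) ?W" and G: "tame_n m UNIV (Suc (n + 2)) ?G" for m
    using decaying_solution_tame(1,2)[OF sol Suc.IH source_order(1)] unfolding source_order by blast+
  \<comment> \<open>\<open>?D\<close> is the x-derivative of \<open>?W\<close>, hence of the same
    order uniformly in k. Solving its formula for the last term bounds
    \<open>2 * \<i> * of_real k * ?W k x\<close>, which is the next scaled source up to a
    constant.\<close>
  let ?D = "\<lambda>k x. of_real (V x) * ?G k x + ?S k x - 2 * \<i> * of_real k * ?W k x"
  have D: "tame_n m UNIV (n + 2) ?D"
    by (rule tame_n_derivative[OF W]) (use sol in \<open>simp add: decaying_solution_def\<close>)
  have "tame_n m UNIV (n + 2) (\<lambda>k x. of_real (V x) * ?G k x)"
    using tame_n_V_mult[OF G, where j = 0] tame_n_mono by fastforce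
  moreover have "tame_n m UNIV (n + 2) ?S"
    using Suc.IH by (rule tame_n_mono) (simp add: source_order_def)
  ultimately have T: "tame_n m UNIV (n + 2)
      (\<lambda>k x. - of_nat (Suc n) * (of_real (V x) * ?G k x + ?S k x + - 1 * ?D k x))"
    using D by (intro tame_n_cmult tame_n_add)
  have eq: "- of_nat (Suc n) * (of_real (V x) * ?G k x + ?S k x + - 1 * ?D k x)
      = of_real k ^ Suc n * source (Suc n) k x" for k x
    by (simp add: algebra_simps)
  have "tame_n m UNIV (n + 2) (\<lambda>k x. of_real k ^ Suc n * source (Suc n) k x)"
    using tame_n_cong[THEN iffD1, OF eq T] .
  then show ?case by (simp add: source_order_def del: power_Suc source_simps)
next
  case 0
  show ?case using source_tame[of m 0] by (simp add: source_0)
qed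

lemma scaled_mder_tame:
  "tame_n m UNIV (n + 2) (\<lambda>k x. of_real k ^ n * mder_x n k x)"
  "tame UNIV (n + 2) (\<lambda>k x. of_real k ^ Suc n * mder n k x)"
proof -
  have sol: "decaying_solution k (\<lambda>x. of_real k ^ n * source n k x)
      (\<lambda>x. of_real k ^ n * mder n k x) (\<lambda>x. of_real k ^ n * mder_x n k x)" for k
    by (rule decaying_solution_cmult[OF mder_solution])
  show "tame_n m UNIV (n + 2) (\<lambda>k x. of_real k ^ n * mder_x n k x)"
    "tame UNIV (n + 2) (\<lambda>k x. of_real k ^ Suc n * mder n k x)"
    using decaying_solution_tame(1,3)[OF sol scaled_source_tame source_order(1)]
    unfolding source_order power_Suc mult.assoc by blast+
qed

section \<open>Difference quotients in k\<close>

definition quotient_domain :: "(real \<times> real) set" where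
  "quotient_domain = {(k, \<delta>). \<delta> \<noteq> 0}"

definition diff_quotient :: "(real \<Rightarrow> real \<Rightarrow> complex) \<Rightarrow> real \<times> real \<Rightarrow> real \<Rightarrow> complex" where
  "diff_quotient g = (\<lambda>(k, \<delta>) x. 1 / of_real \<delta> * (g (k + \<delta>) x + - 1 * g k x))"

text \<open>If \<open>h\<close> is the k-derivative of \<open>g\<close>, this is the Taylor
  remainder divided by the square of \<delta>. A bound uniform in \<delta> therefore proves
  differentiability.\<close>

definition taylor_quotient ::
  "(real \<Rightarrow> real \<Rightarrow> complex) \<Rightarrow> (real \<Rightarrow> real \<Rightarrow> complex) \<Rightarrow> real \<times> real \<Rightarrow> real \<Rightarrow> complex" where
  "taylor_quotient g h = (\<lambda>(k, \<delta>) x. 1 / of_real \<delta> * (diff_quotient g (k, \<delta>) x + - 1 * h k x))"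

text \<open>Moving the equation from k + \<delta> to k adds a multiple of \<delta> to the source;
  after division by \<delta> it becomes the term with \<open>mder_x n (fst i + snd i)\<close>, tame
  by reindexing.\<close>

lemma diff_quotient_solution:
  assumes "i \<in> quotient_domain"
  shows "decaying_solution (fst i)
    (\<lambda>x. diff_quotient (source n) i x - 2 * \<i> * mder_x n (fst i + snd i) x)
    (diff_quotient (mder n) i) (diff_quotient (mder_x n) i)"
proof -
  obtain k \<delta> where i: "i = (k, \<delta>)" "\<delta> \<noteq> 0"
    using assms by (auto simp: quotient_domain_def)
  have "decaying_solution k
      (\<lambda>x. 1 / of_real \<delta> * (source n (k + \<delta>) x - 2 * \<i> * of_real \<delta> * mder_x n (k + \<delta>) x + - 1 * source n k x))
      (\<lambda>x. 1 / of_real \<delta> * (mder n (k + \<delta>) x + - 1 * mder n k x))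
      (\<lambda>x. 1 / of_real \<delta> * (mder_x n (k + \<delta>) x + - 1 * mder_x n k x))"
    by (intro decaying_solution_cmult decaying_solution_add decaying_solution_shift mder_solution)
  moreover have "1 / of_real \<delta> * (source n (k + \<delta>) x - 2 * \<i> * of_real \<delta> * mder_x n (k + \<delta>) x + - 1 * source n k x)
      = diff_quotient (source n) i x - 2 * \<i> * mder_x n (fst i + snd i) x" for x
    using i by (simp add: diff_quotient_def field_simps)
  ultimately show ?thesis by (simp add: i diff_quotient_def)
qed

lemma mder_x_shift_tame:
  "tame_n m quotient_domain (n + 2) (\<lambda>i. mder_x n (fst i + snd i))"
  using mder_x_tame by (rule tame_n_reindex) simp

text \<open>Some finite order is enough for differentiability, so no sharp \<open>c\<close> is
  tracked. The induction starts because the source V does not depend on k and its quotient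
  vanishes.\<close>

lemma diff_quotient_mder_x_tame:
  "\<exists>c\<ge>2. \<forall>m. tame_n m quotient_domain c (diff_quotient (mder_x n))"
proof -
  have key: "\<exists>d\<ge>2. \<forall>m. tame_n m quotient_domain d (diff_quotient (mder_x n))"
    if S: "\<And>m. tame_n m quotient_domain c
        (\<lambda>i x. diff_quotient (source n) i x - 2 * \<i> * mder_x n (fst i + snd i) x)" and c: "2 \<le> c" for n c
    using decaying_solution_tame(1)[OF diff_quotient_solution S] c
    by (intro exI[of _ "gain c"]) (auto simp: gain_def)
  show ?thesis
  proof (induction n)
    case 0
    have "tame_n m quotient_domain 2 (\<lambda>i x. (- 2 * \<i>) * mder_x 0 (fst i + snd i) x)" for m
      using mder_x_shift_tame[of m 0] by (intro tame_n_cmult) (simp add: numeral_2_eq_2)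
    then show ?case
      by (intro key[of 2]) (auto simp: diff_quotient_def case_prod_beta)
  next
    case (Suc n)
    then obtain c where c: "2 \<le> c" "\<And>m. tame_n m quotient_domain c (diff_quotient (mder_x n))"
      by blast
    have "tame_n m quotient_domain (max c (n + 3)) (\<lambda>i x. (- 2 * \<i> * of_nat (Suc n)) * diff_quotient (mder_x n) i x
        + (- 2 * \<i>) * mder_x (Suc n) (fst i + snd i) x)" for m
      by (intro tame_n_add tame_n_cmult tame_n_mono[OF c(2)] tame_n_mono[OF mder_x_shift_tame]) auto
    moreover have "(- 2 * \<i> * of_nat (Suc n)) * diff_quotient (mder_x n) i x
        + (- 2 * \<i>) * mder_x (Suc n) (fst i + snd i) x
        = diff_quotient (source (Suc n)) i x - 2 * \<i> * mder_x (Suc n) (fst i + snd i) x" for i x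
      by (simp add: diff_quotient_def case_prod_beta algebra_simps)
    ultimately show ?case
      by (intro key[of "max c (n + 3)"]) (use c in auto)
  qed
qed

lemma taylor_quotient_solution:
  assumes "i \<in> quotient_domain"
  shows "decaying_solution (fst i)
    (\<lambda>x. 1 / of_real (snd i) * (diff_quotient (source n) i x - 2 * \<i> * mder_x n (fst i + snd i) x
      + - 1 * source (Suc n) (fst i) x))
    (taylor_quotient (mder n) (mder (Suc n)) i) (taylor_quotient (mder_x n) (mder_x (Suc n)) i)"
proof -
  have "taylor_quotient g h i
      = (\<lambda>x. 1 / of_real (snd i) * (diff_quotient g i x + - 1 * h (fst i) x))" for g h
    by (simp add: taylor_quotient_def case_prod_beta)
  then show ?thesis
    using assms
    by (simp only:) (intro decaying_solution_cmult decaying_solution_add diff_quotient_solution mder_solution)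
qed

text \<open>In the induction step the coefficient n + 2 of \<open>source (Suc (Suc n))\<close>
  splits as (n + 1) + 1. The first part completes the previous Taylor quotient; the second pairs
  with the shifted term to form a difference quotient of \<open>mder_x (Suc n)\<close>.\<close>

lemma taylor_quotient_tame:
  "\<exists>c\<ge>2. \<forall>m. tame_n m quotient_domain c (taylor_quotient (mder_x n) (mder_x (Suc n))) \<and>
     tame_n m quotient_domain (Suc c) (taylor_quotient (mder n) (mder (Suc n)))"
proof -
  let ?S = "\<lambda>n i x. 1 / of_real (snd i) * (diff_quotient (source n) i x - 2 * \<i> * mder_x n (fst i + snd i) x
      + - 1 * source (Suc n) (fst i) x)"
  have key: "\<exists>d\<ge>2. \<forall>m. tame_n m quotient_domain d (taylor_quotient (mder_x n) (mder_x (Suc n))) \<and>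
       tame_n m quotient_domain (Suc d) (taylor_quotient (mder n) (mder (Suc n)))"
    if "\<And>m. tame_n m quotient_domain c S"
      "\<And>i x. i \<in> quotient_domain \<Longrightarrow> S i x = ?S n i x" and c: "2 \<le> c" for n c S
  proof -
    have "tame_n m quotient_domain c (?S n)" for m
      using that(1,2) tame_n_cong[of quotient_domain S "?S n" m c] by blast
    from decaying_solution_tame(1,2)[OF taylor_quotient_solution this] c
    show ?thesis by (intro exI[of _ "gain c"]) (auto simp: gain_def)
  qed
  show ?thesis
  proof (induction n)
    case 0
    obtain c where c: "2 \<le> c" "\<And>m. tame_n m quotient_domain c (diff_quotient (mder_x 0))"
      using diff_quotient_mder_x_tame by blast
    show ?case
      by (rule key[OF tame_n_cmult[OF c(2), of _ "- 2 * \<i>"] _ c(1)])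
        (auto simp: quotient_domain_def diff_quotient_def field_simps)
  next
    case (Suc n)
    obtain c where c: "2 \<le> c" "\<And>m. tame_n m quotient_domain c (taylor_quotient (mder_x n) (mder_x (Suc n)))"
      using Suc.IH by blast
    obtain d where d: "2 \<le> d" "\<And>m. tame_n m quotient_domain d (diff_quotient (mder_x (Suc n)))"
      using diff_quotient_mder_x_tame by blast
    show ?case
    proof (rule key[where c = "max c d"])
      show "tame_n m quotient_domain (max c d)
          (\<lambda>i x. (- 2 * \<i> * of_nat (Suc n)) * taylor_quotient (mder_x n) (mder_x (Suc n)) i x
            + (- 2 * \<i>) * diff_quotient (mder_x (Suc n)) i x)" for m
        by (intro tame_n_add tame_n_cmult tame_n_mono[OF c(2)] tame_n_mono[OF d(2)]) auto
      show "(- 2 * \<i> * of_nat (Suc n)) * taylor_quotient (mder_x n) (mder_x (Suc n)) i x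
            + (- 2 * \<i>) * diff_quotient (mder_x (Suc n)) i x = ?S (Suc n) i x"
        if "i \<in> quotient_domain" for i x
        using that by (auto simp: quotient_domain_def taylor_quotient_def diff_quotient_def field_simps)
    qed (use c in simp)
  qed
qed

lemma mder_iterate_has_x_derivative:
  "((vderiv ^^ l) (mder n k) has_vector_derivative (vderiv ^^ Suc l) (mder n k) x) (at x)"
  using tame_n_vderiv_iterate(2)[OF mder_tame(1)] by blast

text \<open>At fixed k and \<delta>, x-derivatives commute with the Taylor quotient, so its tameness
  controls the remainder of every x-derivative. This yields differentiability in k and the
  interchange of x- and k-derivatives at once.\<close>

lemma mder_iterate_has_k_derivative:
  "((\<lambda>k. (vderiv ^^ l) (mder n k) x) has_vector_derivative (vderiv ^^ l) (mder (Suc n) k) x) (at k)"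
proof -
  let ?f = "\<lambda>n k x. (vderiv ^^ l) (mder n k) x"
  let ?T = "taylor_quotient (mder n) (mder (Suc n))"
  obtain c where c: "\<And>m. tame_n m quotient_domain c ?T"
    using taylor_quotient_tame by blast
  have T: "(vderiv ^^ j) (?T (k, \<delta>)) =
      (\<lambda>x. 1 / of_real \<delta> * (1 / of_real \<delta> * ((vderiv ^^ j) (mder n (k + \<delta>)) x + - 1 * (vderiv ^^ j) (mder n k) x)
         + - 1 * (vderiv ^^ j) (mder (Suc n) k) x))" for j k \<delta>
  proof (induction j)
    case 0
    then show ?case by (simp add: taylor_quotient_def diff_quotient_def)
  next
    case (Suc j)
    have "((vderiv ^^ j) (?T (k, \<delta>)) has_vector_derivative
        1 / of_real \<delta> * (1 / of_real \<delta> * ((vderiv ^^ Suc j) (mder n (k + \<delta>)) x + - 1 * (vderiv ^^ Suc j) (mder n k) x)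
         + - 1 * (vderiv ^^ Suc j) (mder (Suc n) k) x)) (at x)" for x
      unfolding Suc.IH
      by (intro has_vector_derivative_mult_right has_vector_derivative_add mder_iterate_has_x_derivative)
    then show ?case by (auto simp: fun_eq_iff intro: vector_derivative_at)
  qed
  have "tame quotient_domain c (\<lambda>i. (vderiv ^^ l) (?T i))"
    using tame_n_vderiv_iterate(1)[OF c, of 0 l] by simp
  then obtain C where C: "\<And>i x. i \<in> quotient_domain \<Longrightarrow> norm ((vderiv ^^ l) (?T i) x) \<le> C * wt (- x) ^ c"
    by (rule tame_bound) blast
  define B where "B = C * wt (- x) ^ c"
  have bd: "norm (?f n (k + \<delta>) x - ?f n k x - \<delta> *\<^sub>R ?f (Suc n) k x) \<le> B * \<delta>\<^sup>2" for \<delta>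
  proof (cases "\<delta> = 0")
    case False
    have "?f n (k + \<delta>) x - ?f n k x - \<delta> *\<^sub>R ?f (Suc n) k x = of_real (\<delta>\<^sup>2) * (vderiv ^^ l) (?T (k, \<delta>)) x"
      unfolding T using False by (simp add: field_simps power2_eq_square scaleR_conv_of_real)
    moreover have "norm ((vderiv ^^ l) (?T (k, \<delta>)) x) \<le> B"
      unfolding B_def by (rule C) (use False in \<open>simp add: quotient_domain_def\<close>)
    ultimately show ?thesis
      by (simp add: norm_mult norm_power mult.commute[of B] mult_left_mono)
  qed simp
  have "((\<lambda>\<delta>. norm (?f n (k + \<delta>) x - ?f n k x - \<delta> *\<^sub>R ?f (Suc n) k x) / norm \<delta>) \<longlongrightarrow> 0) (at 0)"
  proof (rule Lim_null_comparison[where g = "\<lambda>\<delta>. B * \<bar>\<delta>\<bar>"])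
    have "((\<lambda>\<delta>::real. B * \<bar>\<delta>\<bar>) \<longlongrightarrow> B * \<bar>0\<bar>) (at 0)" by (intro tendsto_intros)
    then show "((\<lambda>\<delta>::real. B * \<bar>\<delta>\<bar>) \<longlongrightarrow> 0) (at 0)" by simp
    have "norm (norm (?f n (k + \<delta>) x - ?f n k x - \<delta> *\<^sub>R ?f (Suc n) k x) / norm \<delta>) \<le> B * \<bar>\<delta>\<bar>" for \<delta>
      using bd[of \<delta>] by (cases "\<delta> = 0") (auto simp: field_simps power2_eq_square)
    then show "\<forall>\<^sub>F \<delta> in at 0. norm (norm (?f n (k + \<delta>) x - ?f n k x - \<delta> *\<^sub>R ?f (Suc n) k x) / norm \<delta>) \<le> B * \<bar>\<delta>\<bar>"
      by simp
  qed
  then show ?thesis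
    unfolding has_vector_derivative_def has_derivative_at
    by (auto intro: bounded_linear_intros)
qed

end

section \<open>Joint smoothness and Jost functions\<close>

lemma C_n_add:
  "C_n N f \<Longrightarrow> C_n N g \<Longrightarrow> C_n N (\<lambda>p. f p + g p)"
proof (induction N arbitrary: f g)
  case (Suc N)
  have d: "((\<lambda>p. f p + g p) has_derivative
      (\<lambda>v. frechet_derivative f (at p) v + frechet_derivative g (at p) v)) (at p)" for p
    using Suc.prems by (intro has_derivative_add) (auto simp: frechet_derivative_works[symmetric])
  show ?case
    using Suc d by (auto simp: frechet_derivative_at[OF d, symmetric] intro: differentiableI)
qed (simp add: continuous_on_add)

lemma C_n_scaleR:
  "C_n N f \<Longrightarrow> C_n N (\<lambda>p. c *\<^sub>R f p)"
proof (induction N arbitrary: f)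
  case (Suc N)
  have d: "((\<lambda>p. c *\<^sub>R f p) has_derivative (\<lambda>v. c *\<^sub>R frechet_derivative f (at p) v)) (at p)" for p
    using Suc.prems by (intro has_derivative_scaleR_right) (auto simp: frechet_derivative_works[symmetric])
  show ?case
    using Suc d by (auto simp: frechet_derivative_at[OF d, symmetric] intro: differentiableI)
qed (simp add: continuous_on_scaleR)

text \<open>Directional derivatives are linear combinations of two members of the same family, so
  the induction closes when run over all indices together.\<close>

lemma partial_derivatives_C_infinity:
  fixes d :: "nat \<Rightarrow> nat \<Rightarrow> real \<times> real \<Rightarrow> 'b::real_normed_vector"
  assumes d: "\<And>l n p. (d l n has_derivative (\<lambda>h. fst h *\<^sub>R d (Suc l) n p + snd h *\<^sub>R d l (Suc n) p)) (at p)"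
  shows "C_infinity (d l n)"
proof -
  have "C_n N (d l n)" for N l n
  proof (induction N arbitrary: l n)
    case 0
    show ?case
      using has_derivative_continuous[OF d] by (simp add: continuous_at_imp_continuous_on)
  next
    case (Suc N)
    have "(\<lambda>p. frechet_derivative (d l n) (at p) v)
        = (\<lambda>p. fst v *\<^sub>R d (Suc l) n p + snd v *\<^sub>R d l (Suc n) p)" for v
      by (simp only: frechet_derivative_at[OF d, symmetric])
    then show ?case
      using differentiableI[OF d] C_n_add[OF C_n_scaleR[OF Suc.IH] C_n_scaleR[OF Suc.IH]]
      by (simp only: C_n.simps) blast
  qed
  then show ?thesis by (simp add: C_infinity_def)
qed

text \<open>\<open>e l n\<close> plays the role of \<open>\<partial>\<^sub>x\<^sup>l \<partial>\<^sub>k\<^sup>n\<close> of \<open>e 0 0\<close>.\<close>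

locale smooth_jet =
  fixes e :: "nat \<Rightarrow> nat \<Rightarrow> real \<Rightarrow> real \<Rightarrow> complex"
  assumes x_deriv: "\<And>l n x k. ((\<lambda>x. e l n x k) has_vector_derivative e (Suc l) n x k) (at x)"
    and k_deriv: "\<And>l n x k. ((\<lambda>k. e l n x k) has_vector_derivative e l (Suc n) x k) (at k)"
    and growth: "\<And>l n. \<exists>C c. \<forall>x k. norm (e l n x k) \<le> C * (1 + \<bar>x\<bar>) ^ c"
begin

lemma partial_x_iterate: "(partial_x ^^ l) (e 0 n) = e l n"
proof (induction l)
  case (Suc l)
  have "partial_x (e l n) = e (Suc l) n"
    unfolding partial_x_def by (intro ext vector_derivative_at x_deriv)
  with Suc show ?case by simp
qed simp

lemma partial_k_iterate: "(partial_k ^^ n) (e 0 0) = e 0 n"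
proof (induction n)
  case (Suc n)
  have "partial_k (e 0 n) = e 0 (Suc n)"
    unfolding partial_k_def by (intro ext vector_derivative_at k_deriv)
  with Suc show ?case by simp
qed simp

text \<open>The growth bound on the k-derivative makes \<open>e l n\<close> Lipschitz in k, locally
  uniformly in x. This upgrades separate to joint continuity.\<close>

lemma jointly_continuous: "isCont (\<lambda>(x, k). e l n x k) (x0, k0)"
proof -
  obtain C c where C: "\<And>x k. norm (e l (Suc n) x k) \<le> C * (1 + \<bar>x\<bar>) ^ c"
    using growth[of l "Suc n"] by blast
  have inc: "norm (e l n x k2 - e l n x k1) \<le> C * (1 + \<bar>x\<bar>) ^ c * (k2 - k1)" if "k1 \<le> k2" for x k1 k2
  proof -
    let ?B = "C * (1 + \<bar>x\<bar>) ^ c"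
    have "norm (e l n x k2 - e l n x k1) \<le> - (?B * k1) - - (?B * k2)"
    proof (rule increment_bound[OF that k_deriv])
      show "((\<lambda>k. - (?B * k)) has_real_derivative - ?B) (at k)" for k
        by (auto intro!: derivative_eq_intros)
    qed (simp add: C)
    then show ?thesis by (simp add: algebra_simps)
  qed
  have lip: "norm (e l n x k - e l n x k0) \<le> C * (1 + \<bar>x\<bar>) ^ c * \<bar>k - k0\<bar>" for x k
    using inc[of k0 k x] inc[of k k0 x] by (cases "k0 \<le> k") (auto simp: norm_minus_commute abs_if)
  have cont: "isCont (\<lambda>x. e l n x k0) x0"
    using x_deriv by (rule has_vector_derivative_continuous)
  have "((\<lambda>p. norm (e l n (fst p) k0 - e l n x0 k0) + C * (1 + \<bar>fst p\<bar>) ^ c * \<bar>snd p - k0\<bar>)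
      \<longlongrightarrow> norm (e l n x0 k0 - e l n x0 k0) + C * (1 + \<bar>x0\<bar>) ^ c * \<bar>k0 - k0\<bar>) (at (x0, k0))"
    by (intro tendsto_intros isCont_tendsto_compose[OF cont] tendsto_fst[of _ "(x0, k0)", simplified]
        tendsto_snd[of _ "(x0, k0)", simplified])
  then have lim: "((\<lambda>p. norm (e l n (fst p) k0 - e l n x0 k0) + C * (1 + \<bar>fst p\<bar>) ^ c * \<bar>snd p - k0\<bar>)
      \<longlongrightarrow> 0) (at (x0, k0))"
    by simp
  have "((\<lambda>p. e l n (fst p) (snd p) - e l n x0 k0) \<longlongrightarrow> 0) (at (x0, k0))"
  proof (rule Lim_null_comparison[OF always_eventually lim], rule allI)
    fix p
    have "norm (e l n (fst p) (snd p) - e l n x0 k0)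
        \<le> norm (e l n (fst p) (snd p) - e l n (fst p) k0) + norm (e l n (fst p) k0 - e l n x0 k0)"
      using norm_triangle_ineq[of "e l n (fst p) (snd p) - e l n (fst p) k0" "e l n (fst p) k0 - e l n x0 k0"]
      by simp
    then show "norm (e l n (fst p) (snd p) - e l n x0 k0)
        \<le> norm (e l n (fst p) k0 - e l n x0 k0) + C * (1 + \<bar>fst p\<bar>) ^ c * \<bar>snd p - k0\<bar>"
      using lip[of "fst p" "snd p"] by linarith
  qed
  then show ?thesis
    unfolding isCont_def by (simp add: case_prod_beta' LIM_zero_iff)
qed

text \<open>Total differentiability follows from both partial derivatives and joint continuity of
  the one in k, which is \<open>jointly_continuous\<close> at index \<open>Suc n\<close>.\<close>

lemma jet_has_derivative:
  "((\<lambda>(x, k). e l n x k) has_derivative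
    (\<lambda>h. fst h *\<^sub>R (case p of (x, k) \<Rightarrow> e (Suc l) n x k) + snd h *\<^sub>R (case p of (x, k) \<Rightarrow> e l (Suc n) x k))) (at p)"
proof -
  obtain x k where p: "p = (x, k)" by (cases p)
  have "((\<lambda>(x, k). e l n x k) has_derivative
      (\<lambda>(tx, ty). tx *\<^sub>R e (Suc l) n x k + blinfun_apply (blinfun_scaleR_left (e l (Suc n) x k)) ty))
      (at (x, k) within UNIV \<times> UNIV)"
  proof (rule has_derivative_partialsI)
    show "((\<lambda>x. e l n x k) has_derivative (\<lambda>tx. tx *\<^sub>R e (Suc l) n x k)) (at x within UNIV)"
      using x_deriv by (simp add: has_vector_derivative_def)
    show "((\<lambda>y. e l n x y) has_derivative blinfun_apply (blinfun_scaleR_left (e l (Suc n) x y))) (at y within UNIV)"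
      for x y
      using k_deriv by (simp add: has_vector_derivative_def)
    have "isCont (\<lambda>p. blinfun_scaleR_left ((\<lambda>(x, k). e l (Suc n) x k) p)) (x, k)"
      by (intro bounded_linear.isCont[OF bounded_linear_blinfun_scaleR_left] jointly_continuous)
    then show "continuous (at (x, k) within UNIV \<times> UNIV) (\<lambda>(x, y). blinfun_scaleR_left (e l (Suc n) x y))"
      by (simp add: case_prod_beta')
  qed auto
  then show ?thesis by (simp add: p case_prod_beta')
qed

lemma C_infinity_jet: "C_infinity (\<lambda>(x, k). e l n x k)"
  using partial_derivatives_C_infinity[where d = "\<lambda>l n (x, k). e l n x k", OF jet_has_derivative] .

lemma smooth_jet_reflect: "smooth_jet (\<lambda>l n x k. (- 1) ^ l * e l n (- x) k)"
proof
  fix l n x k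
  have "((\<lambda>x. e l n (- x) k) has_vector_derivative (- 1) *\<^sub>R e (Suc l) n (- x) k) (at x)"
    using vector_diff_chain_at[of uminus "- 1" x "\<lambda>x. e l n x k", OF _ x_deriv]
    by (simp add: o_def has_vector_derivative_minus[OF has_vector_derivative_id, simplified])
  from has_vector_derivative_mult_right[OF this, of "(- 1) ^ l"]
  show "((\<lambda>x. (- 1) ^ l * e l n (- x) k) has_vector_derivative (- 1) ^ Suc l * e (Suc l) n (- x) k) (at x)"
    by simp
  show "((\<lambda>k. (- 1) ^ l * e l n (- x) k) has_vector_derivative (- 1) ^ l * e l (Suc n) (- x) k) (at k)"
    by (intro has_vector_derivative_mult_right k_deriv)
next
  fix l n
  obtain C c where "\<And>x k. norm (e l n x k) \<le> C * (1 + \<bar>x\<bar>) ^ c"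
    using growth by blast
  from this[of "- x" for x]
  show "\<exists>C c. \<forall>x k. norm ((- 1) ^ l * e l n (- x) k) \<le> C * (1 + \<bar>x\<bar>) ^ c"
    by (intro exI[of _ C] exI[of _ c]) (auto simp: norm_mult norm_power)
qed

end

text \<open>Taylor expansion over a unit interval bounds \<open>g'\<close> by two values of
  \<open>g\<close> and a bound on \<open>g''\<close>. It is needed because the asymptotics of a Jost
  function prescribe the function but not its derivative.\<close>

lemma derivative_tendsto_0:
  fixes g :: "real \<Rightarrow> 'a::real_normed_vector"
  assumes g: "\<And>x. (g has_vector_derivative g' x) (at x)"
    and g': "\<And>x. (g' has_vector_derivative g'' x) (at x)"
    and lim: "(g \<longlongrightarrow> 0) at_top" "(g'' \<longlongrightarrow> 0) at_top"
  shows "(g' \<longlongrightarrow> 0) at_top"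
proof (rule tendstoI)
  fix r :: real assume "0 < r"
  define s where "s = r / 4"
  have s: "0 < s" using \<open>0 < r\<close> by (simp add: s_def)
  obtain X where X: "\<And>x. X \<le> x \<Longrightarrow> norm (g x) < s"
    using tendstoD[OF lim(1) s] by (auto simp: eventually_at_top_linorder)
  obtain Y where Y: "\<And>x. Y \<le> x \<Longrightarrow> norm (g'' x) < s"
    using tendstoD[OF lim(2) s] by (auto simp: eventually_at_top_linorder)
  have "dist (g' x) 0 < r" if x: "max X Y \<le> x" for x
  proof -
    have 1: "norm (g' t - g' x) \<le> s" if "x \<le> t" "t \<le> x + 1" for t
    proof -
      have "norm (g' t - g' x) \<le> - (s * x) - - (s * t)"
      proof (rule increment_bound[OF that(1) g'])
        show "((\<lambda>t. - (s * t)) has_real_derivative - s) (at t)" for t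
          by (auto intro!: derivative_eq_intros)
      qed (use Y x in \<open>auto intro: less_imp_le\<close>)
      also have "\<dots> = s * (t - x)" by (simp add: algebra_simps)
      also have "\<dots> \<le> s * 1" using that s by (intro mult_left_mono) auto
      finally show ?thesis by simp
    qed
    have "norm ((g (x + 1) - (x + 1) *\<^sub>R g' x) - (g x - x *\<^sub>R g' x)) \<le> - (s * x) - - (s * (x + 1))"
    proof (rule increment_bound)
      show "((\<lambda>t. g t - t *\<^sub>R g' x) has_vector_derivative g' t - g' x) (at t)" for t
        by (rule has_vector_derivative_diff[OF g]) (auto intro!: derivative_eq_intros)
      show "((\<lambda>t. - (s * t)) has_real_derivative - s) (at t)" for t
        by (auto intro!: derivative_eq_intros)
    qed (use 1 in auto)
    then have "norm (g (x + 1) - g x - g' x) \<le> s"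
      by (simp add: algebra_simps)
    moreover have "norm (g' x) \<le> norm (g (x + 1) - g x - g' x) + norm (g (x + 1)) + norm (g x)"
      using norm_triangle_ineq4[of "g (x + 1) - g x" "g (x + 1) - g x - g' x"]
        norm_triangle_ineq4[of "g (x + 1)" "g x"] by simp
    ultimately have "norm (g' x) \<le> s + s + s"
      using X[of x] X[of "x + 1"] x by simp
    then show ?thesis using s by (simp add: s_def)
  qed
  then show "\<forall>\<^sub>F x in at_top. dist (g' x) 0 < r"
    unfolding eventually_at_top_linorder by blast
qed

section \<open>Plane waves and reflected potentials\<close>

abbreviation plane_wave :: "real \<Rightarrow> real \<Rightarrow> complex" where
  "plane_wave k x \<equiv> exp (\<i> * of_real (k * x))"

lemma norm_plane_wave [simp]: "norm (plane_wave k x) = 1"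
  by (simp add: norm_exp_eq_Re)

lemma plane_wave_has_vector_derivative:
  "(plane_wave k has_vector_derivative \<i> * of_real k * plane_wave k x) (at x)"
  using exp_scaleR_has_vector_derivative_right[of "\<i> * of_real k" x UNIV]
  by (simp add: scaleR_conv_of_real ac_simps)

lemma plane_wave_mult_has_vector_derivative:
  assumes "(F has_vector_derivative F') (at x)"
  shows "((\<lambda>x. plane_wave k x * F x) has_vector_derivative
    plane_wave k x * (F' + \<i> * of_real k * F x)) (at x)"
proof -
  have "plane_wave k x * F' + \<i> * of_real k * plane_wave k x * F x
      = plane_wave k x * (F' + \<i> * of_real k * F x)"
    by (simp only: distrib_left ac_simps)
  with has_vector_derivative_mult[OF plane_wave_has_vector_derivative assms, of k] show ?thesis
    by (simp only:)
qed

lemma tendsto_plane_wave_mult_0: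
  assumes "(U \<longlongrightarrow> 0) F"
  shows "((\<lambda>x. plane_wave k x * U x) \<longlongrightarrow> 0) F"
  using assms by (subst tendsto_norm_zero_iff[symmetric]) (simp add: norm_mult tendsto_norm_zero)

lemma schwartz_reflect:
  assumes "schwartz V"
  shows "schwartz (\<lambda>x. V (- x))"
proof -
  interpret schwartz_potential V by (unfold_locales) (rule assms)
  have eq: "(deriv ^^ n) (\<lambda>x. V (- x)) = (\<lambda>x. (- 1) ^ n * (deriv ^^ n) V (- x))" for n
  proof (induction n)
    case (Suc n)
    have "((\<lambda>x. (- 1) ^ n * (deriv ^^ n) V (- x)) has_real_derivative
        (- 1) ^ Suc n * (deriv ^^ Suc n) V (- x)) (at x)" for x
      using DERIV_cmult[OF DERIV_mirror[THEN iffD1, OF V_has_derivative[of n "- x"]], of "(- 1) ^ n"] by simp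
    then show ?case by (auto simp: Suc.IH intro: DERIV_imp_deriv)
  qed simp
  have d: "((deriv ^^ n) (\<lambda>x. V (- x)) has_real_derivative (- 1) ^ Suc n * (deriv ^^ Suc n) V (- x)) (at x)" for n x
    unfolding eq using DERIV_cmult[OF DERIV_mirror[THEN iffD1, OF V_has_derivative[of n "- x"]], of "(- 1) ^ n"] by simp
  show ?thesis
    unfolding schwartz_def
  proof (intro conjI allI)
    show "(deriv ^^ n) (\<lambda>x. V (- x)) field_differentiable (at x)" for n x
      using d unfolding field_differentiable_def by blast
    fix j n
    obtain B where B: "\<And>x. norm (x ^ j * (deriv ^^ n) V x) \<le> B"
      using assms unfolding schwartz_def bounded_iff by blast
    have "norm (x ^ j * (deriv ^^ n) (\<lambda>x. V (- x)) x) \<le> B" for x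
      using B[of "- x"] unfolding eq by (simp add: abs_mult power_abs)
    then show "bounded (range (\<lambda>x. x ^ j * (deriv ^^ n) (\<lambda>x. V (- x)) x))"
      unfolding bounded_iff by blast
  qed
qed

section \<open>Existence and uniqueness of the Jost solution\<close>

context schwartz_potential
begin

lemma decaying_solution_unique:
  assumes "decaying_solution \<kappa> (\<lambda>_. 0) F U"
  shows "F x = 0"
proof -
  obtain a0 where a0: "2 \<le> a0" "\<And>a x. a0 \<le> a \<Longrightarrow> \<bar>V x\<bar> * majorant a x \<le> majorant2 a x / 2"
    by (rule V_majorant) blast
  have "norm (F x) \<le> 2 * 0 * majorant a0 x"
    by (rule decaying_solution_bound[OF assms a0(1)]) (use a0(2) in auto)
  then show ?thesis by simp
qed

lemma V_bounded:
  obtains B where "0 \<le> B" "\<And>x. \<bar>V x\<bar> \<le> B"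
  using V_rapid_decay[of 0 0] by auto

text \<open>By the equation the second derivative decays with \<open>g\<close>, hence so does
  \<open>g'\<close>. After removal of the plane wave, \<open>g\<close> is a decaying solution with
  source 0, which the a priori bound forces to vanish; k = 0 is covered alike.\<close>

lemma schroedinger_solution_eq_0:
  fixes g g' :: "real \<Rightarrow> complex"
  assumes g: "\<And>x. (g has_vector_derivative g' x) (at x)"
    and g': "\<And>x. (g' has_vector_derivative (of_real (V x) - of_real (k\<^sup>2)) * g x) (at x)"
    and lim: "(g \<longlongrightarrow> 0) at_top"
  shows "g x = 0"
proof -
  obtain B where B: "\<And>x. \<bar>V x\<bar> \<le> B" by (rule V_bounded) blast
  have "((\<lambda>x. (of_real (V x) - of_real (k\<^sup>2)) * g x) \<longlongrightarrow> 0) at_top"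
  proof (rule Lim_null_comparison)
    show "((\<lambda>x. (B + k\<^sup>2) * norm (g x)) \<longlongrightarrow> 0) at_top"
      using tendsto_mult_right_zero[OF tendsto_norm_zero[OF lim]] .
    have "norm ((of_real (V x) - of_real (k\<^sup>2)) * g x) \<le> (B + k\<^sup>2) * norm (g x)" for x
    proof -
      have "norm (of_real (V x) - of_real (k\<^sup>2) :: complex) \<le> B + k\<^sup>2"
        using norm_triangle_ineq4[of "of_real (V x) :: complex" "of_real (k\<^sup>2)"] B[of x]
        by (simp add: norm_power)
      then show ?thesis unfolding norm_mult by (intro mult_right_mono) auto
    qed
    then show "\<forall>\<^sub>F x in at_top. norm ((of_real (V x) - of_real (k\<^sup>2)) * g x) \<le> (B + k\<^sup>2) * norm (g x)"
      by simp
  qed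
  from derivative_tendsto_0[OF g g' lim this] have lim': "(g' \<longlongrightarrow> 0) at_top" .
  let ?F = "\<lambda>x. plane_wave (- k) x * g x"
  let ?U = "\<lambda>x. plane_wave (- k) x * (g' x + \<i> * of_real (- k) * g x)"
  have "decaying_solution k (\<lambda>_. 0) ?F ?U"
    unfolding decaying_solution_def
  proof (intro conjI allI)
    show "(?F has_vector_derivative ?U x) (at x)" for x
      by (rule plane_wave_mult_has_vector_derivative[OF g])
    have D: "(?U has_vector_derivative plane_wave (- k) x * (((of_real (V x) - of_real (k\<^sup>2)) * g x
        + \<i> * of_real (- k) * g' x) + \<i> * of_real (- k) * (g' x + \<i> * of_real (- k) * g x))) (at x)" for x
      by (intro plane_wave_mult_has_vector_derivative has_vector_derivative_add
          has_vector_derivative_mult_right g g')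
    have eq: "plane_wave (- k) x * (((of_real (V x) - of_real (k\<^sup>2)) * g x
        + \<i> * of_real (- k) * g' x) + \<i> * of_real (- k) * (g' x + \<i> * of_real (- k) * g x))
        = of_real (V x) * ?F x + 0 - 2 * \<i> * of_real k * ?U x" for x
      by (simp add: algebra_simps power2_eq_square)
    show "(?U has_vector_derivative of_real (V x) * ?F x + 0 - 2 * \<i> * of_real k * ?U x) (at x)" for x
      by (rule D[unfolded eq])
    show "(?F \<longlongrightarrow> 0) at_top" by (rule tendsto_plane_wave_mult_0[OF lim])
    have "((\<lambda>x. g' x + \<i> * of_real (- k) * g x) \<longlongrightarrow> 0 + \<i> * of_real (- k) * 0) at_top"
      by (intro tendsto_intros lim lim')
    then show "(?U \<longlongrightarrow> 0) at_top" by (intro tendsto_plane_wave_mult_0) simp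
  qed
  from decaying_solution_unique[OF this, of x] show ?thesis by simp
qed

lemma asymp_equiv_plane_wave_iff:
  "f \<sim>[at_top] plane_wave k \<longleftrightarrow> ((\<lambda>x. f x / plane_wave k x) \<longlongrightarrow> 1) at_top"
  by (simp add: asymp_equiv_def)

definition jost_solution :: "real \<Rightarrow> real \<Rightarrow> complex" where
  "jost_solution k x = plane_wave k x * (1 + mder 0 k x)"

lemma jost_solution:
  "schroedinger_solution V k (jost_solution k)" "jost_solution k \<sim>[at_top] plane_wave k"
proof -
  let ?U = "\<lambda>x. plane_wave k x * (mder_x 0 k x + \<i> * of_real k * (1 + mder 0 k x))"
  let ?W = "\<lambda>x. plane_wave k x * (((of_real (V x) * mder 0 k x + source 0 k x - 2 * \<i> * of_real k * mder_x 0 k x)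
      + \<i> * of_real k * (0 + mder_x 0 k x)) + \<i> * of_real k * (mder_x 0 k x + \<i> * of_real k * (1 + mder 0 k x)))"
  have "((\<lambda>x. 1 + mder 0 k x) has_vector_derivative 0 + mder_x 0 k x) (at x)" for x
    by (intro has_vector_derivative_add has_vector_derivative_const mder_has_derivative)
  then have "(jost_solution k has_vector_derivative ?U x) (at x)" for x
    unfolding jost_solution_def[abs_def]
    using plane_wave_mult_has_vector_derivative[of "\<lambda>x. 1 + mder 0 k x" "mder_x 0 k x" x k] by simp
  moreover have "(?U has_vector_derivative ?W x) (at x)" for x
    by (intro plane_wave_mult_has_vector_derivative has_vector_derivative_add
        has_vector_derivative_mult_right has_vector_derivative_const mder_has_derivative mder_x_has_derivative)
  moreover have "- ?W x + of_real (V x) * jost_solution k x = of_real (k\<^sup>2) * jost_solution k x" for x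
    by (simp add: jost_solution_def algebra_simps power2_eq_square)
  ultimately show "schroedinger_solution V k (jost_solution k)"
    unfolding schroedinger_solution_def by (intro exI[of _ ?U] exI[of _ ?W]) blast
  have "((\<lambda>x. 1 + mder 0 k x) \<longlongrightarrow> 1 + 0) at_top"
    using mder_solution[of k 0] by (intro tendsto_intros) (simp add: decaying_solution_def)
  then show "jost_solution k \<sim>[at_top] plane_wave k"
    unfolding asymp_equiv_plane_wave_iff by (simp add: jost_solution_def)
qed

lemma jost_solution_unique:
  assumes "schroedinger_solution V k f" "f \<sim>[at_top] plane_wave k"
  shows "f = jost_solution k"
proof
  fix x
  obtain f' f'' where f: "\<And>x. (f has_vector_derivative f' x) (at x)" "\<And>x. (f' has_vector_derivative f'' x) (at x)"
      "\<And>x. - f'' x + of_real (V x) * f x = of_real (k\<^sup>2) * f x"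
    using assms(1) unfolding schroedinger_solution_def by blast
  obtain h' h'' where h: "\<And>x. (jost_solution k has_vector_derivative h' x) (at x)"
      "\<And>x. (h' has_vector_derivative h'' x) (at x)"
      "\<And>x. - h'' x + of_real (V x) * jost_solution k x = of_real (k\<^sup>2) * jost_solution k x"
    using jost_solution(1)[of k] unfolding schroedinger_solution_def by blast
  have "f x - jost_solution k x = 0"
  proof (rule schroedinger_solution_eq_0)
    show "((\<lambda>x. f x - jost_solution k x) has_vector_derivative f' x - h' x) (at x)" for x
      by (intro has_vector_derivative_diff f h)
    have "((\<lambda>x. f' x - h' x) has_vector_derivative f'' x - h'' x) (at x)" for x
      by (intro has_vector_derivative_diff f h)
    moreover have "f'' x - h'' x = (of_real (V x) - of_real (k\<^sup>2)) * (f x - jost_solution k x)" for x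
      using f(3)[of x] h(3)[of x] by (simp add: algebra_simps)
    ultimately show "((\<lambda>x. f' x - h' x) has_vector_derivative
        (of_real (V x) - of_real (k\<^sup>2)) * (f x - jost_solution k x)) (at x)" for x
      by simp
    \<comment> \<open>Both quotients tend to 1, and multiplying their difference by a factor of
      modulus one preserves the limit 0.\<close>
    have "((\<lambda>x. f x / plane_wave k x - jost_solution k x / plane_wave k x) \<longlongrightarrow> 1 - 1) at_top"
      using assms(2) jost_solution(2)[of k] unfolding asymp_equiv_plane_wave_iff by (rule tendsto_diff)
    then have "((\<lambda>x. plane_wave k x * (f x / plane_wave k x - jost_solution k x / plane_wave k x)) \<longlongrightarrow> 0) at_top"
      by (intro tendsto_plane_wave_mult_0) simp
    then show "((\<lambda>x. f x - jost_solution k x) \<longlongrightarrow> 0) at_top"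
      by (simp add: algebra_simps)
  qed
  then show "f x = jost_solution k x" by simp
qed

section \<open>Partial derivatives of m_+ and their bounds\<close>

lemma jost_plus_eq: "jost_plus V x k = jost_solution k x"
proof -
  have "(THE f. schroedinger_solution V k f \<and> f \<sim>[at_top] plane_wave k) = jost_solution k"
    using jost_solution jost_solution_unique by (intro the_equality) blast+
  then show ?thesis by (simp add: jost_plus_def)
qed

lemma m_plus_eq: "m_plus V x k = 1 + mder 0 k x"
  unfolding m_plus_def jost_plus_eq jost_solution_def
  by (simp add: mult.assoc[symmetric] flip: exp_add)

text \<open>\<open>mder 0\<close> represents m_+ - 1, which accounts for the constant at l = n =
  0.\<close>

definition jost_partial :: "nat \<Rightarrow> nat \<Rightarrow> real \<Rightarrow> real \<Rightarrow> complex" where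
  "jost_partial l n x k = (if l = 0 \<and> n = 0 then 1 else 0) + (vderiv ^^ l) (mder n k) x"

lemma m_plus_eq_jost_partial: "m_plus V = jost_partial 0 0"
  by (simp add: fun_eq_iff m_plus_eq jost_partial_def)

lemma vderiv_mder: "vderiv (mder n k) = mder_x n k"
  using vector_derivative_at[OF mder_has_derivative] by auto

text \<open>Undoes the shift by 2 in the order: cancelling the square of \<open>wt (- x)\<close>
  leaves growth n.\<close>

lemma tame_bound_left:
  assumes "tame I (n + 2) g"
  obtains C where "0 \<le> C" "\<And>i x. i \<in> I \<Longrightarrow> norm (g i x) \<le> C * wt (- x) ^ n"
proof -
  obtain C where C: "0 \<le> C"
    "\<And>i x. i \<in> I \<Longrightarrow> norm (g i x) * wt x ^ 0 * (wt (- x))\<^sup>2 \<le> C * wt (- x) ^ (n + 2)"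
    using assms by (rule tameE[where N = 0]) blast
  have "norm (g i x) \<le> C * wt (- x) ^ n" if "i \<in> I" for i x
  proof -
    have "norm (g i x) * (wt (- x))\<^sup>2 \<le> C * wt (- x) ^ n * (wt (- x))\<^sup>2"
      using C(2)[OF that, of x] by (simp add: power_add power2_eq_square ac_simps)
    then show ?thesis by (rule mult_right_le_imp_le) simp
  qed
  with C(1) show thesis by (rule that)
qed

lemma mder_partial_bounds:
  "\<exists>C\<ge>0. \<forall>x k. norm ((vderiv ^^ Suc l) (mder n k) x) \<le> C * wt (- x) ^ n"
  "\<exists>C\<ge>0. \<forall>x k. \<bar>k\<bar> ^ n * norm ((vderiv ^^ Suc l) (mder n k) x) \<le> C * wt (- x) ^ n"
  "\<exists>C\<ge>0. \<forall>x k. norm (mder n k x) \<le> C * wt (- x) ^ Suc n"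
  "\<exists>C\<ge>0. \<forall>x k. \<bar>k\<bar> * norm (mder n k x) \<le> C * wt (- x) ^ n"
  "\<exists>C\<ge>0. \<forall>x k. \<bar>k\<bar> ^ Suc n * norm (mder n k x) \<le> C * wt (- x) ^ n"
proof -
  have it: "(vderiv ^^ Suc l) (mder n k) = (vderiv ^^ l) (mder_x n k)" for l k
    by (simp only: funpow_Suc_right o_apply vderiv_mder)
  have "tame UNIV (n + 2) (\<lambda>k. (vderiv ^^ l) (mder_x n k))"
    using tame_n_vderiv_iterate(1)[of UNIV "n + 2" "mder_x n" 0 l, OF mder_x_tame] by simp
  then show "\<exists>C\<ge>0. \<forall>x k. norm ((vderiv ^^ Suc l) (mder n k) x) \<le> C * wt (- x) ^ n"
    unfolding it by (rule tame_bound_left) blast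
  have s: "(vderiv ^^ l) (\<lambda>x. of_real k ^ n * mder_x n k x) = (\<lambda>x. of_real k ^ n * (vderiv ^^ l) (mder_x n k) x)"
    for l k
  proof (induction l)
    case (Suc l)
    have "((\<lambda>x. of_real k ^ n * (vderiv ^^ l) (mder_x n k) x) has_vector_derivative
        of_real k ^ n * (vderiv ^^ Suc l) (mder_x n k) x) (at x)" for x
      by (intro has_vector_derivative_mult_right tame_n_vderiv_iterate(2)[OF mder_x_tame]) simp
    from vector_derivative_at[OF this] show ?case by (simp add: Suc.IH fun_eq_iff)
  qed simp
  have "tame UNIV (n + 2) (\<lambda>k. (vderiv ^^ l) (\<lambda>x. of_real k ^ n * mder_x n k x))"
    using tame_n_vderiv_iterate(1)[of UNIV "n + 2" "\<lambda>k x. of_real k ^ n * mder_x n k x" 0 l, OF scaled_mder_tame(1)]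
    by simp
  then have "tame UNIV (n + 2) (\<lambda>k x. of_real k ^ n * (vderiv ^^ Suc l) (mder n k) x)"
    unfolding s it .
  then show "\<exists>C\<ge>0. \<forall>x k. \<bar>k\<bar> ^ n * norm ((vderiv ^^ Suc l) (mder n k) x) \<le> C * wt (- x) ^ n"
    by (rule tame_bound_left) (auto simp: norm_mult norm_power simp del: funpow.simps)
  have "tame UNIV (Suc n + 2) (mder n)"
    using mder_tame(1)[of 0 n] by simp
  then show "\<exists>C\<ge>0. \<forall>x k. norm (mder n k x) \<le> C * wt (- x) ^ Suc n"
    by (rule tame_bound_left) blast
  show "\<exists>C\<ge>0. \<forall>x k. \<bar>k\<bar> * norm (mder n k x) \<le> C * wt (- x) ^ n"
    by (rule tame_bound_left[OF mder_tame(2)]) (auto simp: norm_mult)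
  show "\<exists>C\<ge>0. \<forall>x k. \<bar>k\<bar> ^ Suc n * norm (mder n k x) \<le> C * wt (- x) ^ n"
    by (rule tame_bound_left[OF scaled_mder_tame(2)]) (auto simp: norm_mult norm_power simp del: power_Suc)
qed

lemma jost_partial_bound:
  "\<exists>C\<ge>0. \<forall>x k. norm (jost_partial l n x k) \<le> C * (if l \<ge> 1 then wt (- x) ^ n else wt (- x) ^ (n + 1))"
proof (cases l)
  case (Suc j)
  then show ?thesis using mder_partial_bounds(1)[of j n] by (simp add: jost_partial_def del: funpow.simps)
next
  case 0
  obtain C where C: "0 \<le> C" "\<And>x k. norm (mder n k x) \<le> C * wt (- x) ^ Suc n"
    using mder_partial_bounds(3)[of n] by blast
  have "norm (jost_partial 0 n x k) \<le> (1 + C) * wt (- x) ^ Suc n" for x k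
  proof -
    have "norm (jost_partial 0 n x k) \<le> 1 + norm (mder n k x)"
      unfolding jost_partial_def by (rule order_trans[OF norm_triangle_ineq]) simp
    also have "\<dots> \<le> 1 * wt (- x) ^ Suc n + C * wt (- x) ^ Suc n"
      using C(2) wt_ge_1[of "- x"] by (intro add_mono) (auto simp del: power_Suc intro: one_le_power)
    finally show ?thesis by (simp add: algebra_simps)
  qed
  with 0 C(1) show ?thesis by (intro exI[of _ "1 + C"]) auto
qed

text \<open>For l = 0 the general bound on \<open>of_real k ^ n * mder n k x\<close> would carry
  weight n + 1. Weight n is available with the factors |k| and |k|^(n+1) instead, and for n \<ge> 1
  the power |k|^n lies below their sum.\<close>

lemma jost_partial_scaled_bound:
  assumes "n \<ge> 1 \<or> l \<ge> 1"
  shows "\<exists>C\<ge>0. \<forall>x k. k \<noteq> 0 \<longrightarrow> norm (jost_partial l n x k) \<le> C * (wt (- x) ^ n / \<bar>k\<bar> ^ n)"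
proof (cases l)
  case (Suc j)
  obtain C where C: "0 \<le> C" "\<And>x k. \<bar>k\<bar> ^ n * norm ((vderiv ^^ Suc j) (mder n k) x) \<le> C * wt (- x) ^ n"
    using mder_partial_bounds(2)[of n j] by blast
  have "norm (jost_partial l n x k) \<le> C * (wt (- x) ^ n / \<bar>k\<bar> ^ n)" if "k \<noteq> 0" for x k
    using C(2)[of k x] that Suc by (simp add: jost_partial_def field_simps del: funpow.simps)
  with C(1) show ?thesis by blast
next
  case 0
  then have n: "n \<ge> 1" using assms by simp
  obtain C where C: "0 \<le> C" "\<And>x k. \<bar>k\<bar> * norm (mder n k x) \<le> C * wt (- x) ^ n"
    using mder_partial_bounds(4)[of n] by blast
  obtain D where D: "0 \<le> D" "\<And>x k. \<bar>k\<bar> ^ Suc n * norm (mder n k x) \<le> D * wt (- x) ^ n"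
    using mder_partial_bounds(5)[of n] by blast
  have "norm (jost_partial l n x k) \<le> (C + D) * (wt (- x) ^ n / \<bar>k\<bar> ^ n)" if "k \<noteq> 0" for x k
  proof -
    have "\<bar>k\<bar> ^ n \<le> \<bar>k\<bar> + \<bar>k\<bar> ^ Suc n"
    proof (cases "\<bar>k\<bar> \<le> 1")
      case True
      then have "\<bar>k\<bar> ^ n \<le> \<bar>k\<bar> ^ 1" using n by (intro power_decreasing) auto
      then show ?thesis by (simp add: add_increasing2)
    next
      case False
      then have "\<bar>k\<bar> ^ n \<le> \<bar>k\<bar> ^ Suc n" by (intro power_increasing) auto
      then show ?thesis by (simp add: add_increasing)
    qed
    then have "\<bar>k\<bar> ^ n * norm (mder n k x) \<le> (\<bar>k\<bar> + \<bar>k\<bar> ^ Suc n) * norm (mder n k x)"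
      by (rule mult_right_mono) simp
    also have "\<dots> \<le> (C + D) * wt (- x) ^ n"
      using C(2)[of k x] D(2)[of k x] by (simp add: algebra_simps)
    finally show ?thesis
      using that 0 n by (simp add: jost_partial_def field_simps)
  qed
  with C(1) D(1) show ?thesis by (intro exI[of _ "C + D"]) auto
qed

lemma smooth_jet_jost_partial: "smooth_jet jost_partial"
proof
  fix l n x k
  have "((\<lambda>x. (if l = 0 \<and> n = 0 then 1 else 0) + (vderiv ^^ l) (mder n k) x) has_vector_derivative
      0 + (vderiv ^^ Suc l) (mder n k) x) (at x)"
    by (intro has_vector_derivative_add has_vector_derivative_const mder_iterate_has_x_derivative)
  then show "((\<lambda>x. jost_partial l n x k) has_vector_derivative jost_partial (Suc l) n x k) (at x)"
    by (simp add: jost_partial_def)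
  have "((\<lambda>k. (if l = 0 \<and> n = 0 then 1 else 0) + (vderiv ^^ l) (mder n k) x) has_vector_derivative
      0 + (vderiv ^^ l) (mder (Suc n) k) x) (at k)"
    by (intro has_vector_derivative_add has_vector_derivative_const mder_iterate_has_k_derivative)
  then show "((\<lambda>k. jost_partial l n x k) has_vector_derivative jost_partial l (Suc n) x k) (at k)"
    by (simp add: jost_partial_def)
next
  fix l n
  obtain C where C: "0 \<le> C" "\<And>x k. norm (jost_partial l n x k)
      \<le> C * (if l \<ge> 1 then wt (- x) ^ n else wt (- x) ^ (n + 1))"
    using jost_partial_bound by blast
  have "norm (jost_partial l n x k) \<le> C * (1 + \<bar>x\<bar>) ^ (n + 1)" for x k
  proof -
    have "(if l \<ge> 1 then wt (- x) ^ n else wt (- x) ^ (n + 1)) \<le> wt (- x) ^ (n + 1)"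
      using power_increasing[of n "n + 1" "wt (- x)"] wt_ge_1 by simp
    also have "\<dots> \<le> (1 + \<bar>x\<bar>) ^ (n + 1)"
      by (intro power_mono) (auto simp: wt_def)
    finally show ?thesis using C order_trans mult_left_mono by meson
  qed
  then show "\<exists>C c. \<forall>x k. norm (jost_partial l n x k) \<le> C * (1 + \<bar>x\<bar>) ^ c" by blast
qed

end

section \<open>Reflection: from m_+ to m_-\<close>

lemma schroedinger_solution_reflect:
  assumes "schroedinger_solution V k f"
  shows "schroedinger_solution (\<lambda>x. V (- x)) k (\<lambda>x. f (- x))"
proof -
  obtain f' f'' where f: "\<And>x. (f has_vector_derivative f' x) (at x)" "\<And>x. (f' has_vector_derivative f'' x) (at x)"
      "\<And>x. - f'' x + of_real (V x) * f x = of_real (k\<^sup>2) * f x"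
    using assms unfolding schroedinger_solution_def by blast
  have refl: "((\<lambda>x. g (- x)) has_vector_derivative - g' (- x)) (at x)"
    if "\<And>x. (g has_vector_derivative g' x) (at x)" for g g' :: "real \<Rightarrow> complex" and x
    using vector_diff_chain_at[of uminus "- 1" x g, OF _ that]
    by (simp add: o_def has_vector_derivative_minus[OF has_vector_derivative_id, simplified])
  have "((\<lambda>x. - f' (- x)) has_vector_derivative f'' (- x)) (at x)" for x
    using has_vector_derivative_minus[OF refl[OF f(2)]] by simp
  with refl[OF f(1)] f(3) show ?thesis
    unfolding schroedinger_solution_def
    by (intro exI[of _ "\<lambda>x. - f' (- x)"] exI[of _ "\<lambda>x. f'' (- x)"]) blast
qed

text \<open>Reflection preserves the equation, with \<open>V\<close> reflected, and exchanges the
  two ends of the line. Uniqueness at the right end thus settles the definite description at the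
  left end.\<close>

lemma m_minus_eq_m_plus_reflect:
  assumes "schwartz V"
  shows "m_minus V x k = m_plus (\<lambda>x. V (- x)) (- x) k"
proof -
  interpret R: schwartz_potential "\<lambda>x. V (- x)"
    using schwartz_reflect[OF assms] by unfold_locales
  have asy: "f \<sim>[at_bot] (\<lambda>y. exp (- \<i> * of_real (k * y))) \<longleftrightarrow> (\<lambda>x. f (- x)) \<sim>[at_top] plane_wave k" for f
    by (simp add: asymp_equiv_def filterlim_at_bot_mirror)
  have "(THE f. schroedinger_solution V k f \<and> f \<sim>[at_bot] (\<lambda>y. exp (- \<i> * of_real (k * y))))
      = (\<lambda>x. R.jost_solution k (- x))"
  proof (rule the_equality)
    show "schroedinger_solution V k (\<lambda>x. R.jost_solution k (- x)) \<and>
        (\<lambda>x. R.jost_solution k (- x)) \<sim>[at_bot] (\<lambda>y. exp (- \<i> * of_real (k * y)))"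
      using schroedinger_solution_reflect[OF R.jost_solution(1)] R.jost_solution(2) unfolding asy by simp
    fix f
    assume f: "schroedinger_solution V k f \<and> f \<sim>[at_bot] (\<lambda>y. exp (- \<i> * of_real (k * y)))"
    then have "(\<lambda>x. f (- x)) = R.jost_solution k"
      using schroedinger_solution_reflect asy by (intro R.jost_solution_unique) blast+
    then show "f = (\<lambda>x. R.jost_solution k (- x))" by (auto simp: fun_eq_iff dest: spec[of _ "- x" for x])
  qed
  then show ?thesis
    by (simp add: m_minus_def jost_minus_def m_plus_def R.jost_plus_eq)
qed

theorem lemma4p2:
  fixes V :: "real \<Rightarrow> real"
  assumes "schwartz V"
  shows "C_infinity (\<lambda>(x, k). m_plus V x k) \<and> C_infinity (\<lambda>(x, k). m_minus V x k) \<and>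
    (\<forall>l n. \<exists>c::real. \<forall>x k.
       norm ((partial_x ^^ l) ((partial_k ^^ n) (m_plus V)) x k)
         \<le> c * (if l \<ge> 1 then (1 + max 0 (- x)) ^ n else (1 + max 0 (- x)) ^ (n + 1)) \<and>
       norm ((partial_x ^^ l) ((partial_k ^^ n) (m_minus V)) x k)
         \<le> c * (if l \<ge> 1 then (1 + max 0 x) ^ n else (1 + max 0 x) ^ (n + 1))) \<and>
    (\<forall>l n. n \<ge> 1 \<or> l \<ge> 1 \<longrightarrow> (\<exists>c::real. \<forall>x k. k \<noteq> 0 \<longrightarrow>
       norm ((partial_x ^^ l) ((partial_k ^^ n) (m_plus V)) x k)
         \<le> c * ((1 + max 0 (- x)) ^ n / \<bar>k\<bar> ^ n) \<and>
       norm ((partial_x ^^ l) ((partial_k ^^ n) (m_minus V)) x k)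
         \<le> c * ((1 + max 0 x) ^ n / \<bar>k\<bar> ^ n)))"
proof -
  interpret P: schwartz_potential V using assms by unfold_locales
  interpret R: schwartz_potential "\<lambda>x. V (- x)"
    using schwartz_reflect[OF assms] by unfold_locales
  interpret P: smooth_jet P.jost_partial by (rule P.smooth_jet_jost_partial)
  interpret R: smooth_jet R.jost_partial by (rule R.smooth_jet_jost_partial)
  \<comment> \<open>The jet of \<open>m_minus V\<close>: each x-derivative of a reflected function
    contributes a sign.\<close>
  define r where "r l n x k = (- 1) ^ l * R.jost_partial l n (- x) k" for l n x k
  interpret M: smooth_jet r unfolding r_def[abs_def] by (rule R.smooth_jet_reflect)
  have plus: "m_plus V = P.jost_partial 0 0" by (rule P.m_plus_eq_jost_partial)
  have minus: "m_minus V = r 0 0"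
    by (simp add: fun_eq_iff m_minus_eq_m_plus_reflect[OF assms] R.m_plus_eq_jost_partial r_def)
  have r_norm: "norm (r l n x k) = norm (R.jost_partial l n (- x) k)" for l n x k
    by (simp add: r_def norm_mult norm_power)
  show ?thesis
    unfolding plus minus P.partial_k_iterate P.partial_x_iterate M.partial_k_iterate M.partial_x_iterate
      r_norm wt_def[symmetric]
  proof (intro conjI allI impI)
    show "C_infinity (\<lambda>(x, k). P.jost_partial 0 0 x k)" by (rule P.C_infinity_jet)
    show "C_infinity (\<lambda>(x, k). r 0 0 x k)" by (rule M.C_infinity_jet)
  next
    fix l n :: nat
    obtain C where C: "0 \<le> C" "\<And>x k. norm (P.jost_partial l n x k)
        \<le> C * (if l \<ge> 1 then wt (- x) ^ n else wt (- x) ^ (n + 1))"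
      using P.jost_partial_bound by blast
    obtain D where D: "0 \<le> D" "\<And>x k. norm (R.jost_partial l n x k)
        \<le> D * (if l \<ge> 1 then wt (- x) ^ n else wt (- x) ^ (n + 1))"
      using R.jost_partial_bound by blast
    \<comment> \<open>One constant has to serve both m_+ and m_-; \<open>C + D\<close> does, since
      the weights are nonnegative.\<close>
    have w: "0 \<le> (if l \<ge> 1 then wt x ^ n else wt x ^ (n + 1))" for x by simp
    have "norm (P.jost_partial l n x k) \<le> (C + D) * (if l \<ge> 1 then wt (- x) ^ n else wt (- x) ^ (n + 1)) \<and>
        norm (R.jost_partial l n (- x) k) \<le> (C + D) * (if l \<ge> 1 then wt x ^ n else wt x ^ (n + 1))" for x k
      using C(2)[of x k] D(2)[of "- x" k] mult_nonneg_nonneg[OF D(1) w[of "- x"]] mult_nonneg_nonneg[OF C(1) w[of x]]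
      unfolding distrib_right minus_minus by linarith
    then show "\<exists>c. \<forall>x k. norm (P.jost_partial l n x k) \<le> c * (if l \<ge> 1 then wt (- x) ^ n else wt (- x) ^ (n + 1)) \<and>
        norm (R.jost_partial l n (- x) k) \<le> c * (if l \<ge> 1 then wt x ^ n else wt x ^ (n + 1))"
      by blast
  next
    fix l n :: nat assume ln: "n \<ge> 1 \<or> l \<ge> 1"
    obtain C where C: "0 \<le> C" "\<And>x k. k \<noteq> 0 \<Longrightarrow> norm (P.jost_partial l n x k) \<le> C * (wt (- x) ^ n / \<bar>k\<bar> ^ n)"
      using P.jost_partial_scaled_bound[OF ln] by blast
    obtain D where D: "0 \<le> D" "\<And>x k. k \<noteq> 0 \<Longrightarrow> norm (R.jost_partial l n x k) \<le> D * (wt (- x) ^ n / \<bar>k\<bar> ^ n)"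
      using R.jost_partial_scaled_bound[OF ln] by blast
    have w: "0 \<le> wt x ^ n / \<bar>k\<bar> ^ n" for x k by simp
    have "norm (P.jost_partial l n x k) \<le> (C + D) * (wt (- x) ^ n / \<bar>k\<bar> ^ n) \<and>
        norm (R.jost_partial l n (- x) k) \<le> (C + D) * (wt x ^ n / \<bar>k\<bar> ^ n)" if "k \<noteq> 0" for x k
      using C(2)[OF that, of x] D(2)[OF that, of "- x"]
        mult_nonneg_nonneg[OF D(1) w[of "- x" k]] mult_nonneg_nonneg[OF C(1) w[of x k]]
      unfolding distrib_right minus_minus by linarith
    then show "\<exists>c. \<forall>x k. k \<noteq> 0 \<longrightarrow> norm (P.jost_partial l n x k) \<le> c * (wt (- x) ^ n / \<bar>k\<bar> ^ n) \<and>
        norm (R.jost_partial l n (- x) k) \<le> c * (wt x ^ n / \<bar>k\<bar> ^ n)"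
      by blast
  qed
qed

end
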